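(* Let $(\Xi^n)_{n\ge 0}$ be generated by an edge iterated graph system satisfying the standing assumptions (canonical, distance-positive, degree-primitive, single-edge initial graph). Then the walk dimension of simple random walk on $\Xi$ satisfies $$\dim_{\mathrm W}(\Xi)\ge2.$$
   Context: **EIGS.** Fix $K\ge1$ colours $[K]=\{1,\dots,K\}$. An edge iterated graph system (EIGS) consists of finite directed rule graphs $R_1,\dots,R_K$ whose edges are coloured by a map $\mathscr C$ with values in $[K]$, each $R_i$ having two distinct planting vertices $\beta_i^+\ne\beta_i^-$, and an initial graph $\Xi^0$, which is a single directed edge of some colour with endpoints $\mathfrak v_+,\mathfrak v_-$. Given $\Xi^n$, the graph $\Xi^{n+1}$ is obtained by simultaneously replacing every directed edge $e=(a,b)$ of colour $i$ by a fresh copy of $R_i$, identifying $a\equiv\beta_i^+$, $b\equiv\beta_i^-$, with no other identifications. Thus $V(\Xi^n)\subset V(\Xi^{n+1})$, and $V(\Xi):=\bigcup_nV(\Xi^n)$. The birth level of $v$ is the least $k$ with $v\in V(\Xi^k)$. $\Xi_j^n$ denotes the graph obtained when the initial edge has colour $j$. Distances $d_G$, degrees, paths, balls $B_G(v,r)=\{u:d_G(v,u)<r\}$, random walks and resistances refer to underlying undirected graphs, which are assumed simple and connected. **Matrices.** $\mathbf N\in\mathbb N^{2K\times2K}$ has rows $\kappa_{R_1}(\beta_1^+),\kappa_{R_1}(\beta_1^-),\dots,\kappa_{R_K}(\beta_K^+),\kappa_{R_K}(\beta_K^-)$, where $[\kappa_G(v)]_{2j-1}$ (resp. $[\kappa_G(v)]_{2j}$)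 is the number of $j$-coloured edges of $G$ leaving (resp. entering) $v$. $\mathcal D$ is the finite set of $K\times K$ matrices obtained by choosing, for each $i$, a simple path in $R_i$ between $\beta_i^+$ and $\beta_i^-$ and letting the $(i,j)$ entry be the number of $j$-coloured edges on the chosen path. $\rho(\cdot)$ is the spectral radius and $\rho_{\min}(\mathcal D)=\min_{D\in\mathcal D}\rho(D)$. **Standing assumptions.** (1) Canonical: every edge of every $R_i$ lies on a simple path joining $\beta_i^+$ and $\beta_i^-$. (2) Distance-positive: all matrices in $\mathcal D$ have positive entries; if $K=1$, additionally $d_{R_1}(\beta_1^+,\beta_1^-)\ge2$. (3) $\mathbf N$ is primitive. (4) $\Xi^0$ is a single edge. **Walk dimension.** Constants $c_{\mathrm d},C_{\mathrm d}>0$ are fixed with $c_{\mathrm d}\rho_{\min}(\mathcal D)^m\le d_{\Xi_j^m}(\mathfrak v_+,\mathfrak v_-)\le\mathrm{diam}(\Xi_j^m)\le C_{\mathrm d}\rho_{\min}(\mathcal D)^m$ for all $j\in[K]$, $m\in\mathbb N$, and an integer $c_0$ is fixed so large that $C_{\mathrm d}\rho_{\min}(\mathcal D)^{-c_0}\le\frac{c_{\mathrm d}}{4\rho_{\min}(\mathcal D)}$ and $c_{\mathrm d}\rho_{\min}(\mathcal D)^{c_0}\ge4C_{\mathrm d}$. For $v$ of birth level $k$, a sequence $(r_n)_{n\ge k}$ is admissible for $v$ if $r_n\to\infty$ and there are integers $m_n$ such that, for all large $n$, $c_0\le m_n\le n-k-c_0$ and $c_{\mathrm d}\rho_{\min}(\mathcal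 D)^{m_n}\le r_n\le C_{\mathrm d}\rho_{\min}(\mathcal D)^{m_n}$. With $\tau^{\Xi^n}_{B^{\mathrm c}}$ the first time simple random walk on $\Xi^n$ is outside $B$, $\dim_{\mathrm W}(\Xi)$ is the common value, over all $v\in V(\Xi)$ and all admissible $(r_n)$, of $\lim_{n\to\infty}\frac{\log\mathbb E^v[\tau^{\Xi^n}_{B_{\Xi^n}(v,r_n)^{\mathrm c}}]}{\log r_n}$ (this limit exists and is independent of $v$ and of the admissible sequence). It equals $\frac{\log(\rho(\mathbf M)\rho(\Psi))}{\log\rho_{\min}(\mathcal D)}$, where $[\mathbf M]_{ij}$ is the number of $j$-coloured edges of $R_i$; $[\Psi(\mathbf x)]_i$ is the effective resistance between $\beta_i^+,\beta_i^-$ in $R_i$ when $j$-coloured edges have resistance $[\mathbf x]_j$; and $\rho(\Psi)>0$ is the unique number for which $\Psi(\mathbf v)=\rho(\Psi)\mathbf v$ for some $\mathbf v\in(0,\infty)^K$. *)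

theory Defs
  imports
    "HOL-Probability.Probability"
    "Graph_Theory.Graph_Theory"
    "Jordan_Normal_Form.Spectral_Radius"
begin

section \<open>Underlying undirected graphs\<close>

definition undirected :: "('v, 'e) pre_digraph \<Rightarrow> ('v, 'v \<times> 'v) pre_digraph" where
  "undirected G = with_proj (mk_symmetric G)"

definition simple_undirected :: "('v, 'e) pre_digraph \<Rightarrow> bool" where
  "simple_undirected G \<longleftrightarrow> digraph G \<and>
     (\<forall>e \<in> arcs G. \<forall>f \<in> arcs G. \<not> (tail G e = head G f \<and> head G e = tail G f))"

definition simple_path :: "('v, 'e) pre_digraph \<Rightarrow> 'v \<Rightarrow> ('v \<times> 'v) list \<Rightarrow> 'v \<Rightarrow> bool" where
  "simple_path G u p v \<longleftrightarrow> pre_digraph.apath (undirected G) u p v"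

definition on_path :: "('v, 'e) pre_digraph \<Rightarrow> ('v \<times> 'v) list \<Rightarrow> 'e \<Rightarrow> bool" where
  "on_path G p e \<longleftrightarrow> (tail G e, head G e) \<in> set p \<or> (head G e, tail G e) \<in> set p"

definition gdist :: "('v, 'e) pre_digraph \<Rightarrow> 'v \<Rightarrow> 'v \<Rightarrow> nat" where
  "gdist G u v = (LEAST l. \<exists>p. pre_digraph.awalk (undirected G) u p v \<and> length p = l)"

definition gdiam :: "('v, 'e) pre_digraph \<Rightarrow> nat" where
  "gdiam G = Max {gdist G u v | u v. u \<in> verts G \<and> v \<in> verts G}"

definition gball :: "('v, 'e) pre_digraph \<Rightarrow> 'v \<Rightarrow> real \<Rightarrow> 'v set" where
  "gball G v r = {u \<in> verts G. real (gdist G v u) < r}"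

definition neighbours :: "('v, 'e) pre_digraph \<Rightarrow> 'v \<Rightarrow> 'v set" where
  "neighbours G v = {u. (v, u) \<in> arcs (undirected G)}"


section \<open>Simple random walk and exit times\<close>

definition srw_kernel ::
    "('v, 'e) pre_digraph \<Rightarrow> 'v \<Rightarrow> nat \<Rightarrow> (nat \<Rightarrow> 'v) \<Rightarrow> 'v measure" where
  "srw_kernel G v t \<omega> = measure_pmf (case t of
       0 \<Rightarrow> return_pmf v
     | Suc s \<Rightarrow> pmf_of_set (neighbours G (\<omega> s)))"

lemma Ionescu_Tulcea_srw:
  "Ionescu_Tulcea (srw_kernel G v) (\<lambda>_. count_space UNIV)"
proof (rule Ionescu_Tulcea.intro)
  fix t :: nat
  show "srw_kernel G v t \<in> PiM {0..<t} (\<lambda>_. count_space UNIV) \<rightarrow>\<^sub>M subprob_algebra (count_space UNIV)"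
  proof (cases t)
    case 0
    have *: "srw_kernel G v t = (\<lambda>_. measure_pmf (return_pmf v))"
      by (simp add: srw_kernel_def fun_eq_iff 0)
    show ?thesis
      unfolding * by (rule measurable_const) (rule measure_pmf_in_subprob_algebra)
  next
    case (Suc s)
    have *: "srw_kernel G v t = (\<lambda>x. measure_pmf (pmf_of_set (neighbours G x))) \<circ> (\<lambda>\<omega>. \<omega> s)"
      by (simp add: srw_kernel_def fun_eq_iff Suc)
    have "(\<lambda>\<omega>. \<omega> s) \<in> PiM {0..<t} (\<lambda>_. count_space UNIV) \<rightarrow>\<^sub>M count_space UNIV"
      using Suc by (intro measurable_component_singleton) auto
    moreover have "(\<lambda>x. measure_pmf (pmf_of_set (neighbours G x)))
        \<in> count_space UNIV \<rightarrow>\<^sub>M subprob_algebra (count_space UNIV)"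
      by (simp add: measure_pmf_in_subprob_algebra)
    ultimately show ?thesis
      unfolding * by (rule measurable_comp)
  qed
qed (simp add: srw_kernel_def prob_space_measure_pmf)

text \<open>
  Law on trajectories of the walk started at v: the Ionescu-Tulcea limit of the kernels above.
\<close>

definition srw :: "('v, 'e) pre_digraph \<Rightarrow> 'v \<Rightarrow> (nat \<Rightarrow> 'v) measure" where
  "srw G v = projective_family.lim UNIV
     (Ionescu_Tulcea.CI (srw_kernel G v) (\<lambda>_. count_space UNIV)) (\<lambda>_. count_space UNIV)"

text \<open>The value is \<open>\<infinity>\<close> on trajectories that never leave B (infimum of the empty set).\<close>

definition exit_time :: "'v set \<Rightarrow> (nat \<Rightarrow> 'v) \<Rightarrow> ennreal" where
  "exit_time B \<omega> = (INF t \<in> {t. \<omega> t \<notin> B}. of_nat t)"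

definition mean_exit_time :: "('v, 'e) pre_digraph \<Rightarrow> 'v \<Rightarrow> 'v set \<Rightarrow> ennreal" where
  "mean_exit_time G v B = (\<integral>\<^sup>+ \<omega>. exit_time B \<omega> \<partial>srw G v)"


section \<open>Edge iterated graph systems\<close>

record ('v, 'e) coloured_digraph =
  gr :: "('v, 'e) pre_digraph"
  ecol :: "'e \<Rightarrow> nat"

text \<open>
  Colours are \<open>0, \<dots>, ncol S - 1\<close>; only rule graphs with such an index matter.
  The initial graph is determined by the colour \<open>init_col\<close> of its edge.
\<close>

record ('a, 'e) eigs =
  ncol :: nat
  rule_graph :: "nat \<Rightarrow> ('a, 'e) coloured_digraph"
  plant_pos :: "nat \<Rightarrow> 'a"
  plant_neg :: "nat \<Rightarrow> 'a"
  init_col :: nat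

abbreviation rule :: "('a, 'e) eigs \<Rightarrow> nat \<Rightarrow> ('a, 'e) pre_digraph" where
  "rule S i \<equiv> gr (rule_graph S i)"

definition is_eigs :: "('a, 'e) eigs \<Rightarrow> bool" where
  "is_eigs S \<longleftrightarrow> 1 \<le> ncol S \<and> init_col S < ncol S \<and>
     (\<forall>i < ncol S.
        simple_undirected (rule S i) \<and> Digraph_Component.connected (rule S i) \<and>
        plant_pos S i \<in> verts (rule S i) \<and> plant_neg S i \<in> verts (rule S i) \<and>
        plant_pos S i \<noteq> plant_neg S i \<and>
        (\<forall>e \<in> arcs (rule S i). ecol (rule_graph S i) e < ncol S))"

text \<open>
  An edge of \<open>\<Xi>\<^sup>n\<close> is identified by the list of the n rule edges leading to it, latest first: \<open>e # w\<close> is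
  the copy of the rule edge e in the graph replacing the edge w. A vertex \<open>Copy w x\<close> is the copy of
  the rule vertex x (not a planting vertex) in the graph replacing w. As w has length n for an edge
  of \<open>\<Xi>\<^sup>n\<close>, the vertices \<open>Copy w x\<close> added at different steps are different.
\<close>

datatype ('a, 'e) xi_vertex = End_pos | End_neg | Copy "'e list" 'a

type_synonym ('a, 'e) xi_graph = "(('a, 'e) xi_vertex, 'e list) coloured_digraph"

definition planted :: "('a, 'e) eigs \<Rightarrow> ('a, 'e) xi_graph \<Rightarrow> 'e list \<Rightarrow> 'a \<Rightarrow> ('a, 'e) xi_vertex" where
  "planted S G w x =
     (if x = plant_pos S (ecol G w) then tail (gr G) w
      else if x = plant_neg S (ecol G w) then head (gr G) w
      else Copy w x)"

definition replace_edges :: "('a, 'e) eigs \<Rightarrow> ('a, 'e) xi_graph \<Rightarrow> ('a, 'e) xi_graph" where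
  "replace_edges S G = \<lparr>
     gr = \<lparr>
       verts = verts (gr G) \<union>
         {planted S G w x | w x. w \<in> arcs (gr G) \<and> x \<in> verts (rule S (ecol G w))},
       arcs = {e # w | e w. w \<in> arcs (gr G) \<and> e \<in> arcs (rule S (ecol G w))},
       tail = (\<lambda>f. planted S G (tl f) (tail (rule S (ecol G (tl f))) (hd f))),
       head = (\<lambda>f. planted S G (tl f) (head (rule S (ecol G (tl f))) (hd f))) \<rparr>,
     ecol = (\<lambda>f. ecol (rule_graph S (ecol G (tl f))) (hd f)) \<rparr>"

definition single_edge :: "nat \<Rightarrow> ('a, 'e) xi_graph" where
  "single_edge j = \<lparr>
     gr = \<lparr> verts = {End_pos, End_neg}, arcs = {[]}, tail = (\<lambda>_. End_pos), head = (\<lambda>_. End_neg) \<rparr>,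
     ecol = (\<lambda>_. j) \<rparr>"

definition Xi_from :: "('a, 'e) eigs \<Rightarrow> nat \<Rightarrow> nat \<Rightarrow> (('a, 'e) xi_vertex, 'e list) pre_digraph" where
  "Xi_from S j n = gr ((replace_edges S ^^ n) (single_edge j))"

definition Xi :: "('a, 'e) eigs \<Rightarrow> nat \<Rightarrow> (('a, 'e) xi_vertex, 'e list) pre_digraph" where
  "Xi S n = Xi_from S (init_col S) n"

definition Xi_verts :: "('a, 'e) eigs \<Rightarrow> ('a, 'e) xi_vertex set" where
  "Xi_verts S = (\<Union>n. verts (Xi S n))"

definition birth_level :: "('a, 'e) eigs \<Rightarrow> ('a, 'e) xi_vertex \<Rightarrow> nat" where
  "birth_level S v = (LEAST k. v \<in> verts (Xi S k))"


section \<open>Matrices and standing assumptions\<close>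

definition out_count :: "('v, 'e) coloured_digraph \<Rightarrow> 'v \<Rightarrow> nat \<Rightarrow> nat" where
  "out_count G v j = card {e \<in> arcs (gr G). tail (gr G) e = v \<and> ecol G e = j}"

definition in_count :: "('v, 'e) coloured_digraph \<Rightarrow> 'v \<Rightarrow> nat \<Rightarrow> nat" where
  "in_count G v j = card {e \<in> arcs (gr G). head (gr G) e = v \<and> ecol G e = j}"

text \<open>
  Indices start at 0: row \<open>2 * i\<close> belongs to \<open>plant_pos S i\<close>, row \<open>2 * i + 1\<close> to \<open>plant_neg S i\<close>,
  column \<open>2 * j\<close> counts the leaving and column \<open>2 * j + 1\<close> the entering edges of colour j.
\<close>

definition degree_matrix :: "('a, 'e) eigs \<Rightarrow> nat mat" where
  "degree_matrix S = Matrix.mat (2 * ncol S) (2 * ncol S) (\<lambda>(r, c).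
     let G = rule_graph S (r div 2);
         v = (if even r then plant_pos S (r div 2) else plant_neg S (r div 2))
     in if even c then out_count G v (c div 2) else in_count G v (c div 2))"

definition primitive_mat :: "nat mat \<Rightarrow> bool" where
  "primitive_mat A \<longleftrightarrow> (\<exists>m > 0. \<forall>i < dim_row A. \<forall>j < dim_col A. 0 < (A ^\<^sub>m m) $$ (i, j))"

definition path_matrix :: "('a, 'e) eigs \<Rightarrow> (nat \<Rightarrow> ('a \<times> 'a) list) \<Rightarrow> nat mat" where
  "path_matrix S p = Matrix.mat (ncol S) (ncol S) (\<lambda>(i, j).
     card {e \<in> arcs (rule S i). ecol (rule_graph S i) e = j \<and> on_path (rule S i) (p i) e})"

definition distance_matrices :: "('a, 'e) eigs \<Rightarrow> nat mat set" where
  "distance_matrices S = {path_matrix S p | p.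
     \<forall>i < ncol S. simple_path (rule S i) (plant_pos S i) (p i) (plant_neg S i)}"

definition rho_min :: "('a, 'e) eigs \<Rightarrow> real" where
  "rho_min S = Min ((\<lambda>D. spectral_radius (map_mat of_nat D)) ` distance_matrices S)"

definition canonical :: "('a, 'e) eigs \<Rightarrow> bool" where
  "canonical S \<longleftrightarrow> (\<forall>i < ncol S. \<forall>e \<in> arcs (rule S i).
     \<exists>p. simple_path (rule S i) (plant_pos S i) p (plant_neg S i) \<and> on_path (rule S i) p e)"

definition distance_positive :: "('a, 'e) eigs \<Rightarrow> bool" where
  "distance_positive S \<longleftrightarrow>
     (\<forall>D \<in> distance_matrices S. \<forall>i < ncol S. \<forall>j < ncol S. 0 < D $$ (i, j)) \<and>
     (ncol S = 1 \<longrightarrow> 2 \<le> gdist (rule S 0) (plant_pos S 0) (plant_neg S 0))"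

definition degree_primitive :: "('a, 'e) eigs \<Rightarrow> bool" where
  "degree_primitive S \<longleftrightarrow> primitive_mat (degree_matrix S)"


section \<open>Walk dimension\<close>

definition scale_constants :: "('a, 'e) eigs \<Rightarrow> real \<Rightarrow> real \<Rightarrow> nat \<Rightarrow> bool" where
  "scale_constants S cd Cd c0 \<longleftrightarrow> 0 < cd \<and> 0 < Cd \<and>
     (\<forall>j < ncol S. \<forall>m.
        cd * rho_min S ^ m \<le> real (gdist (Xi_from S j m) End_pos End_neg) \<and>
        gdist (Xi_from S j m) End_pos End_neg \<le> gdiam (Xi_from S j m) \<and>
        real (gdiam (Xi_from S j m)) \<le> Cd * rho_min S ^ m) \<and>
     Cd / rho_min S ^ c0 \<le> cd / (4 * rho_min S) \<and>
     4 * Cd \<le> cd * rho_min S ^ c0"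

text \<open>
  The values \<open>r n\<close> for n below the birth level of v are irrelevant. The inequality
  \<open>m n \<le> n - k - c0\<close> between integers is written without subtraction.
\<close>

definition admissible ::
    "('a, 'e) eigs \<Rightarrow> real \<Rightarrow> real \<Rightarrow> nat \<Rightarrow> ('a, 'e) xi_vertex \<Rightarrow> (nat \<Rightarrow> real) \<Rightarrow> bool" where
  "admissible S cd Cd c0 v r \<longleftrightarrow> filterlim r at_top sequentially \<and>
     (\<exists>m :: nat \<Rightarrow> nat. \<forall>\<^sub>F n in sequentially.
        c0 \<le> m n \<and> m n + birth_level S v + c0 \<le> n \<and>
        cd * rho_min S ^ m n \<le> r n \<and> r n \<le> Cd * rho_min S ^ m n)"

text \<open>
  The walk dimension is d: d is the common value of the limits over all vertices and all admissible
  sequences. The mean exit times are finite for all large n, so \<open>enn2real\<close> loses nothing.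
\<close>

definition has_walk_dimension ::
    "('a, 'e) eigs \<Rightarrow> real \<Rightarrow> real \<Rightarrow> nat \<Rightarrow> real \<Rightarrow> bool" where
  "has_walk_dimension S cd Cd c0 d \<longleftrightarrow>
     (\<forall>v \<in> Xi_verts S. \<forall>r. admissible S cd Cd c0 v r \<longrightarrow>
        (\<lambda>n. ln (enn2real (mean_exit_time (Xi S n) v (gball (Xi S n) v (r n)))) / ln (r n))
          \<longlonglongrightarrow> d)"

end

theory Submission
  imports Defs
begin

text \<open>
  Let \<open>\<tau>\<close> be the exit time from the ball \<open>B\<close> of radius r about v, and \<open>u x = E\<^sup>x \<theta>\<^sup>\<tau>\<close> with
  \<open>\<theta> = 1 - 2\<kappa>\<^sup>2\<close>. As u is \<open>\<theta>\<close>-harmonic in B, a weighted energy estimate with the weight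
  \<open>exp (\<kappa> (r - d(v,\<cdot>))\<^sup>+)\<close> shows that \<open>u v\<close> is at most \<open>exp (-\<kappa> r) / \<kappa>\<close> times the square root of the
  total degree, and \<open>1 - u v \<le> 2\<kappa>\<^sup>2 E\<^sup>v \<tau>\<close>. The number of edges of \<open>\<Xi>\<^sup>n\<close> grows at most exponentially
  in n, so \<open>u v \<le> 1/2\<close> already for \<open>\<kappa>\<close> of order \<open>n / r\<close>. Hence \<open>E\<^sup>v \<tau>\<close> is at least of order
  \<open>r\<^sup>2 / n\<^sup>2\<close>, and for r exponential in n the loss is only logarithmic in r. It suffices to consider
  the balls of radius \<open>cd * rho_min S ^ (n div 2)\<close> about one end of the initial edge.
\<close>

section \<open>Exit times as sums over the killed walk\<close>

text \<open>The transition operator after t steps of the walk killed on leaving \<open>B\<close>,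
  applied to \<open>f\<close> and evaluated at \<open>v\<close>. For \<open>f = 1\<close> it is the
  probability that \<tau> > t.\<close>

definition killed_mean :: "('v, 'e) pre_digraph \<Rightarrow> 'v \<Rightarrow> 'v set \<Rightarrow> nat \<Rightarrow> ('v \<Rightarrow> ennreal) \<Rightarrow> ennreal" where
  "killed_mean G v B t f = (\<integral>\<^sup>+ \<omega>. (\<Prod>s\<le>t. indicator B (\<omega> s)) * f (\<omega> t) \<partial>srw G v)"

text \<open>The law of the walk is a projective limit, but computations need its finite marginals.
  On an initial segment the marginal is the composition \<open>C\<close> of the first n kernels:
  \<open>up_to {0..<n}\<close> is n, so the projection inside \<open>CI\<close> changes
  nothing.\<close>

lemma nn_integral_srw_prefix:
  assumes f: "f \<in> borel_measurable (PiM {0..<n} (\<lambda>_. count_space UNIV))"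
  shows "(\<integral>\<^sup>+ \<omega>. f (restrict \<omega> {0..<n}) \<partial>srw G v) =
    (\<integral>\<^sup>+ \<omega>. f \<omega> \<partial>Ionescu_Tulcea.C (srw_kernel G v) (\<lambda>_. count_space UNIV) 0 n (\<lambda>_. undefined))"
proof -
  interpret IT: Ionescu_Tulcea "srw_kernel G v" "\<lambda>_. count_space UNIV"
    by (rule Ionescu_Tulcea_srw)
  have up: "IT.up_to {0..<n} = n"
  proof (rule antisym)
    show "IT.up_to {0..<n} \<le> n"
      by (simp add: IT.up_to_iff)
    have "{0..<n} \<subseteq> {0..<IT.up_to {0..<n}}"
      by (rule IT.up_to) simp
    then show "n \<le> IT.up_to {0..<n}"
      by (cases n) auto
  qed
  have CI: "IT.CI {0..<n} = IT.C 0 n (\<lambda>_. undefined)"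
    using IT.distr_C[of n n "\<lambda>_. undefined" 0] by (simp add: IT.CI_def up)
  have srw: "srw G v = IT.PF.lim"
    by (simp add: srw_def)
  have "(\<integral>\<^sup>+ \<omega>. f \<omega> \<partial>IT.CI {0..<n}) = (\<integral>\<^sup>+ \<omega>. f \<omega> \<partial>distr IT.PF.lim (PiM {0..<n} (\<lambda>_. count_space UNIV)) (\<lambda>x. restrict x {0..<n}))"
    by (simp add: IT.distr_lim)
  also have "\<dots> = (\<integral>\<^sup>+ \<omega>. f (restrict \<omega> {0..<n}) \<partial>srw G v)"
    unfolding srw
    by (rule nn_integral_distr)
       (auto simp: f measurable_cong_sets[OF IT.PF.sets_lim refl] intro!: measurable_restrict measurable_component_singleton)
  finally show ?thesis
    by (simp add: CI)
qed

text \<open>The index set is left open since the integrand occurs both on finite prefixes and on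
  full trajectories.\<close>

lemma borel_measurable_killed:
  fixes f :: "'v \<Rightarrow> ennreal" and t :: nat
  assumes "{..t} \<subseteq> I"
  shows "(\<lambda>\<omega>. (\<Prod>s\<le>t. indicator B (\<omega> s)) * f (\<omega> t)) \<in> borel_measurable (PiM I (\<lambda>_. count_space UNIV))"
proof (intro borel_measurable_times_ennreal borel_measurable_prod_ennreal)
  have *: "(\<lambda>\<omega>. h (\<omega> s)) \<in> borel_measurable (PiM I (\<lambda>_. count_space UNIV))" if "s \<le> t" for h :: "'v \<Rightarrow> ennreal" and s
    by (rule measurable_compose[OF measurable_component_singleton]) (use that assms in auto)
  show "(\<lambda>\<omega>. f (\<omega> t)) \<in> borel_measurable (PiM I (\<lambda>_. count_space UNIV))"
    by (rule *[OF order_refl])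
  show "(\<lambda>\<omega>. indicator B (\<omega> s) :: ennreal) \<in> borel_measurable (PiM I (\<lambda>_. count_space UNIV))" if "s \<in> {..t}" for s
    using that by (intro *) simp
qed

lemma sets_srw: "sets (srw G v) = sets (PiM UNIV (\<lambda>_. count_space UNIV))"
proof -
  interpret IT: Ionescu_Tulcea "srw_kernel G v" "\<lambda>_. count_space UNIV"
    by (rule Ionescu_Tulcea_srw)
  show ?thesis
    by (simp add: srw_def)
qed

lemma borel_measurable_killed_srw:
  "(\<lambda>\<omega>. (\<Prod>s\<le>t. indicator B (\<omega> s)) * f (\<omega> t) :: ennreal) \<in> borel_measurable (srw G v)"
  by (subst measurable_cong_sets[OF sets_srw refl]) (rule borel_measurable_killed, simp)

lemma killed_mean_C:
  "killed_mean G v B t f =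
    (\<integral>\<^sup>+ \<omega>. (\<Prod>s\<le>t. indicator B (\<omega> s)) * f (\<omega> t)
      \<partial>Ionescu_Tulcea.C (srw_kernel G v) (\<lambda>_. count_space UNIV) 0 (Suc t) (\<lambda>_. undefined))"
  unfolding killed_mean_def
  using nn_integral_srw_prefix[OF borel_measurable_killed[of t "{0..<Suc t}" B f], of G v]
  by (simp add: subset_iff)

lemma nn_integral_C_Suc:
  assumes f: "f \<in> borel_measurable (PiM {0..<Suc n} (\<lambda>_. count_space UNIV))"
  shows "(\<integral>\<^sup>+ \<omega>. f \<omega> \<partial>Ionescu_Tulcea.C (srw_kernel G v) (\<lambda>_. count_space UNIV) 0 (Suc n) (\<lambda>_. undefined)) =
    (\<integral>\<^sup>+ \<omega>. (\<integral>\<^sup>+ x. f (fun_upd \<omega> n x) \<partial>srw_kernel G v n \<omega>)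
      \<partial>Ionescu_Tulcea.C (srw_kernel G v) (\<lambda>_. count_space UNIV) 0 n (\<lambda>_. undefined))"
proof -
  interpret IT: Ionescu_Tulcea "srw_kernel G v" "\<lambda>_. count_space UNIV"
    by (rule Ionescu_Tulcea_srw)
  have sp: "space (IT.C 0 n (\<lambda>_. undefined)) = space (PiM {0..<n} (\<lambda>_. count_space UNIV))"
    using IT.space_C[of "\<lambda>_. undefined" 0 n] by simp
  have st: "sets (IT.C 0 n (\<lambda>_. undefined)) = sets (PiM {0..<n} (\<lambda>_. count_space UNIV))"
    using IT.sets_C[of "\<lambda>_. undefined" 0 n] by simp
  have "(\<integral>\<^sup>+ \<omega>. f \<omega> \<partial>IT.C 0 (Suc n) (\<lambda>_. undefined)) =
     (\<integral>\<^sup>+ \<omega>. (\<integral>\<^sup>+ x. f x \<partial>IT.eP n \<omega>) \<partial>IT.C 0 n (\<lambda>_. undefined))"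
    using IT.measurable_eP[of n]
    by (simp add: nn_integral_bind[OF f] measurable_cong_sets[OF st refl])
  also have "\<dots> = (\<integral>\<^sup>+ \<omega>. (\<integral>\<^sup>+ x. f (fun_upd \<omega> n x) \<partial>srw_kernel G v n \<omega>) \<partial>IT.C 0 n (\<lambda>_. undefined))"
    by (intro nn_integral_cong IT.nn_integral_eP f) (simp add: sp)
  finally show ?thesis .
qed

lemma killed_mean_0:
  "killed_mean G v B 0 f = indicator B v * f v"
proof -
  interpret IT: Ionescu_Tulcea "srw_kernel G v" "\<lambda>_. count_space UNIV"
    by (rule Ionescu_Tulcea_srw)
  have m: "(\<lambda>\<omega>. (\<Prod>s\<le>0. indicator B (\<omega> s)) * f (\<omega> 0)) \<in> borel_measurable (PiM {0..<Suc 0} (\<lambda>_. count_space UNIV))"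
    by (rule borel_measurable_killed) auto
  show ?thesis
    unfolding killed_mean_C by (subst nn_integral_C_Suc[OF m]) (simp add: srw_kernel_def IT.C.simps space_PiM emeasure_return sets_PiM_empty)
qed

text \<open>The Markov property with the last step peeled off: the start \<open>v\<close> stays
  fixed and the function is replaced by its killed one-step average. Induction on t along this
  recursion must let \<open>f\<close> vary.\<close>

lemma killed_mean_Suc:
  "killed_mean G v B (Suc t) f =
    killed_mean G v B t (\<lambda>x. \<integral>\<^sup>+ y. indicator B y * f y \<partial>measure_pmf (pmf_of_set (neighbours G x)))"
proof -
  have m: "(\<lambda>\<omega>. (\<Prod>s\<le>Suc t. indicator B (\<omega> s)) * f (\<omega> (Suc t))) \<in> borel_measurable (PiM {0..<Suc (Suc t)} (\<lambda>_. count_space UNIV))"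
    by (rule borel_measurable_killed) auto
  have p: "(\<Prod>s\<le>Suc t. indicator B ((fun_upd \<omega> (Suc t) x) s)) = (\<Prod>s\<le>t. indicator B (\<omega> s)) * (indicator B x :: ennreal)" for \<omega> x
    by simp
  show ?thesis
    unfolding killed_mean_C
    by (subst nn_integral_C_Suc[OF m])
       (simp only: p, simp add: srw_kernel_def mult.assoc nn_integral_cmult)
qed

text \<open>The product over s \<le> t is the indicator of \<tau> > t, and summing these indicators
  counts the times before the exit. On trajectories that never leave \<open>B\<close> both sides are
  infinite.\<close>

lemma exit_time_suminf:
  "exit_time B \<omega> = (\<Sum>t. \<Prod>s\<le>t. indicator B (\<omega> s))"
proof (cases "\<exists>t. \<omega> t \<notin> B")
  case True
  define T where "T = (LEAST t. \<omega> t \<notin> B)"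
  have T: "\<omega> T \<notin> B"
    unfolding T_def using True by (rule LeastI_ex)
  have less: "\<omega> t \<in> B" if "t < T" for t
    using not_less_Least[of t "\<lambda>t. \<omega> t \<notin> B"] that unfolding T_def by auto
  have pr: "(\<Prod>s\<le>t. indicator B (\<omega> s)) = (if t < T then 1 else 0 :: ennreal)" for t
  proof (cases "t < T")
    case True
    then show ?thesis by (auto intro!: prod.neutral simp: less)
  next
    case False
    then have "T \<in> {..t}" by simp
    with T show ?thesis using False by (auto simp: prod_zero_iff intro!: bexI[of _ T])
  qed
  have "(\<Sum>t. \<Prod>s\<le>t. indicator B (\<omega> s)) = (\<Sum>t<T. 1 :: ennreal)"
    unfolding pr by (subst suminf_finite[of "{..<T}"]) auto
  also have "\<dots> = of_nat T"
    by simp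
  also have "\<dots> = exit_time B \<omega>"
    unfolding exit_time_def
  proof (rule antisym)
    show "of_nat T \<le> (INF t \<in> {t. \<omega> t \<notin> B}. of_nat t :: ennreal)"
    proof (rule INF_greatest)
      fix t assume "t \<in> {t. \<omega> t \<notin> B}"
      then have "T \<le> t" using less not_le by blast
      then show "of_nat T \<le> (of_nat t :: ennreal)" by simp
    qed
    show "(INF t \<in> {t. \<omega> t \<notin> B}. of_nat t :: ennreal) \<le> of_nat T"
      by (rule INF_lower) (simp add: T)
  qed
  finally show ?thesis by simp
next
  case False
  then have "(\<Prod>s\<le>t. indicator B (\<omega> s)) = (1 :: ennreal)" for t
    by (intro prod.neutral) auto
  moreover have "(\<Sum>t::nat. 1 :: ennreal) = \<infinity>"
    using nn_integral_count_space_nat[of "\<lambda>_. 1"] by (simp add: emeasure_count_space_infinite)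
  ultimately show ?thesis
    using False by (simp add: exit_time_def)
qed

lemma mean_exit_time_suminf:
  "mean_exit_time G v B = (\<Sum>t. killed_mean G v B t (\<lambda>_. 1))"
proof -
  have "mean_exit_time G v B = (\<integral>\<^sup>+ \<omega>. (\<Sum>t. (\<Prod>s\<le>t. indicator B (\<omega> s)) * 1) \<partial>srw G v)"
    by (simp add: mean_exit_time_def exit_time_suminf)
  also have "\<dots> = (\<Sum>t. killed_mean G v B t (\<lambda>_. 1))"
    unfolding killed_mean_def
    by (intro nn_integral_suminf borel_measurable_killed_srw[where f = "\<lambda>_. 1"])
  finally show ?thesis .
qed

section \<open>Supersolutions and subsolutions\<close>

text \<open>A walk started in the closed set \<open>C\<close> stays there, so only values on
  \<open>C\<close> within \<open>B\<close> matter. Finite nonempty neighbourhoods ensure that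
  \<open>pmf_of_set\<close> is supported on the neighbours.\<close>

lemma killed_mean_mono:
  assumes v: "v \<in> C"
    and C: "\<And>x. x \<in> C \<Longrightarrow> neighbours G x \<noteq> {} \<and> finite (neighbours G x) \<and> neighbours G x \<subseteq> C"
    and le: "\<And>x. x \<in> C \<Longrightarrow> x \<in> B \<Longrightarrow> f x \<le> g x"
  shows "killed_mean G v B t f \<le> killed_mean G v B t g"
  using le
proof (induction t arbitrary: f g)
  case 0
  then show ?case using v by (auto simp: killed_mean_0 indicator_def)
next
  case (Suc t)
  have "(\<integral>\<^sup>+ y. indicator B y * f y \<partial>measure_pmf (pmf_of_set (neighbours G x)))
      \<le> (\<integral>\<^sup>+ y. indicator B y * g y \<partial>measure_pmf (pmf_of_set (neighbours G x)))" if "x \<in> C" for x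
    using C[OF that] Suc.prems
    by (intro nn_integral_mono_AE) (auto simp: AE_measure_pmf_iff indicator_def)
  then show ?case
    unfolding killed_mean_Suc by (intro Suc.IH)
qed

lemma nn_integral_neighbours:
  assumes "neighbours G x \<noteq> {}" "finite (neighbours G x)" "\<And>y. y \<in> neighbours G x \<Longrightarrow> 0 \<le> f y"
  shows "(\<integral>\<^sup>+ y. ennreal (f y) \<partial>measure_pmf (pmf_of_set (neighbours G x))) =
    ennreal ((\<Sum>y\<in>neighbours G x. f y) / card (neighbours G x))"
  using assms
  by (subst nn_integral_pmf_of_set)
     (auto simp: sum_ennreal sum_nonneg card_gt_0_iff divide_ennreal ennreal_of_nat_eq_real_of_nat)

lemma killed_mean_add:
  "killed_mean G v B t (\<lambda>x. f x + g x) = killed_mean G v B t f + killed_mean G v B t g"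
  unfolding killed_mean_def distrib_left
  by (intro nn_integral_add borel_measurable_killed_srw)

lemma killed_mean_cmult:
  "killed_mean G v B t (\<lambda>x. c * f x) = c * killed_mean G v B t f"
proof -
  have "killed_mean G v B t (\<lambda>x. c * f x) = (\<integral>\<^sup>+ \<omega>. c * ((\<Prod>s\<le>t. indicator B (\<omega> s)) * f (\<omega> t)) \<partial>srw G v)"
    by (simp add: killed_mean_def mult.left_commute)
  also have "\<dots> = c * killed_mean G v B t f"
    unfolding killed_mean_def by (intro nn_integral_cmult borel_measurable_killed_srw)
  finally show ?thesis .
qed

text \<open>A Lyapunov function argument: inside \<open>B\<close> each step lowers \<open>g\<close>
  by at least 1 in the mean, and \<open>g\<close> stays nonnegative, so the mean time spent before
  the exit is at most \<open>g v\<close>.\<close>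

lemma mean_exit_time_finite:
  fixes g :: "'v \<Rightarrow> real"
  assumes v: "v \<in> C"
    and C: "\<And>x. x \<in> C \<Longrightarrow> neighbours G x \<noteq> {} \<and> finite (neighbours G x) \<and> neighbours G x \<subseteq> C"
    and nonneg: "\<And>x. x \<in> C \<Longrightarrow> 0 \<le> g x"
    and super: "\<And>x. x \<in> C \<Longrightarrow> x \<in> B \<Longrightarrow> 1 + (\<Sum>y\<in>neighbours G x. g y) / card (neighbours G x) \<le> g x"
  shows "mean_exit_time G v B < \<infinity>"
proof -
  let ?F = "killed_mean G v B"
  have step: "?F t (\<lambda>_. 1) + ?F (Suc t) g \<le> ?F t g" for t
  proof -
    have "?F t (\<lambda>_. 1) + ?F (Suc t) g = ?F t (\<lambda>x. 1 + (\<integral>\<^sup>+ y. indicator B y * ennreal (g y) \<partial>measure_pmf (pmf_of_set (neighbours G x))))"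
      by (simp add: killed_mean_Suc killed_mean_add)
    also have "\<dots> \<le> ?F t g"
    proof (rule killed_mean_mono[OF v C])
      fix x assume x: "x \<in> C" "x \<in> B"
      have "(\<integral>\<^sup>+ y. indicator B y * ennreal (g y) \<partial>measure_pmf (pmf_of_set (neighbours G x)))
          \<le> (\<integral>\<^sup>+ y. ennreal (g y) \<partial>measure_pmf (pmf_of_set (neighbours G x)))"
        by (intro nn_integral_mono) (simp add: indicator_def)
      also have "\<dots> = ennreal ((\<Sum>y\<in>neighbours G x. g y) / card (neighbours G x))"
        using C[OF x(1)] nonneg by (intro nn_integral_neighbours) auto
      finally have "1 + (\<integral>\<^sup>+ y. indicator B y * ennreal (g y) \<partial>measure_pmf (pmf_of_set (neighbours G x)))
          \<le> ennreal 1 + ennreal ((\<Sum>y\<in>neighbours G x. g y) / card (neighbours G x))"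
        by (simp add: add_left_mono)
      also have "\<dots> = ennreal (1 + (\<Sum>y\<in>neighbours G x. g y) / card (neighbours G x))"
        using C[OF x(1)] nonneg by (intro ennreal_plus[symmetric] divide_nonneg_nonneg sum_nonneg) auto
      also have "\<dots> \<le> ennreal (g x)"
        by (intro ennreal_leI super x)
      finally show "1 + (\<integral>\<^sup>+ y. indicator B y * ennreal (g y) \<partial>measure_pmf (pmf_of_set (neighbours G x))) \<le> ennreal (g x)" .
    qed auto
    finally show ?thesis .
  qed
  \<comment> \<open>Telescoping \<open>step\<close> bounds all partial sums of the tail
    probabilities by the initial value of \<open>g\<close>.\<close>
  have "(\<Sum>t<n. ?F t (\<lambda>_. 1)) + ?F n g \<le> ?F 0 g" for n
  proof (induction n)
    case (Suc n)
    have "(\<Sum>t<Suc n. ?F t (\<lambda>_. 1)) + ?F (Suc n) g = (\<Sum>t<n. ?F t (\<lambda>_. 1)) + (?F n (\<lambda>_. 1) + ?F (Suc n) g)"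
      by (simp add: add.assoc)
    also have "\<dots> \<le> (\<Sum>t<n. ?F t (\<lambda>_. 1)) + ?F n g"
      by (intro add_left_mono step)
    finally show ?case using Suc.IH by order
  qed simp
  then have "(\<Sum>t<n. ?F t (\<lambda>_. 1)) \<le> ?F 0 g" for n
    by (meson add_increasing2 order_trans order_refl zero_le)
  then have "mean_exit_time G v B \<le> ?F 0 g"
    unfolding mean_exit_time_suminf by (intro suminf_le_const) auto
  also have "\<dots> < \<infinity>"
    by (simp add: killed_mean_0 indicator_def)
  finally show ?thesis .
qed

text \<open>Iterating the subsolution inequality bounds \<open>w v\<close> by a partial sum of tail
  probabilities plus a remainder. The remainder is at most T times the probability of \<tau> > n,
  which tends to 0 because the mean exit time is finite.\<close>

lemma mean_exit_time_ge:
  fixes w :: "'v \<Rightarrow> real"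
  assumes v: "v \<in> C"
    and C: "\<And>x. x \<in> C \<Longrightarrow> neighbours G x \<noteq> {} \<and> finite (neighbours G x) \<and> neighbours G x \<subseteq> C"
    and fin: "mean_exit_time G v B < \<infinity>"
    and nonneg: "\<And>x. x \<in> C \<Longrightarrow> 0 \<le> w x"
    and bounded: "\<And>x. x \<in> C \<Longrightarrow> w x \<le> T"
    and zero: "\<And>x. x \<in> C \<Longrightarrow> x \<notin> B \<Longrightarrow> w x = 0"
    and sub: "\<And>x. x \<in> C \<Longrightarrow> x \<in> B \<Longrightarrow> w x \<le> 1 + (\<Sum>y\<in>neighbours G x. w y) / card (neighbours G x)"
  shows "ennreal (w v) \<le> mean_exit_time G v B"
proof -
  let ?F = "killed_mean G v B"
  have step: "?F t w \<le> ?F t (\<lambda>_. 1) + ?F (Suc t) w" for t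
  proof -
    have "?F t w \<le> ?F t (\<lambda>x. 1 + (\<integral>\<^sup>+ y. indicator B y * ennreal (w y) \<partial>measure_pmf (pmf_of_set (neighbours G x))))"
    proof (rule killed_mean_mono[OF v C])
      fix x assume x: "x \<in> C" "x \<in> B"
      have "ennreal (w x) \<le> ennreal (1 + (\<Sum>y\<in>neighbours G x. w y) / card (neighbours G x))"
        by (intro ennreal_leI sub x)
      also have "\<dots> = ennreal 1 + ennreal ((\<Sum>y\<in>neighbours G x. w y) / card (neighbours G x))"
        using C[OF x(1)] nonneg by (intro ennreal_plus divide_nonneg_nonneg sum_nonneg) auto
      also have "ennreal ((\<Sum>y\<in>neighbours G x. w y) / card (neighbours G x))
        = (\<integral>\<^sup>+ y. ennreal (w y) \<partial>measure_pmf (pmf_of_set (neighbours G x)))"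
        using C[OF x(1)] nonneg by (intro nn_integral_neighbours[symmetric]) auto
      \<comment> \<open>As \<open>w\<close> vanishes outside \<open>B\<close>, inserting the killing
        indicator loses nothing.\<close>
      also have "\<dots> = (\<integral>\<^sup>+ y. indicator B y * ennreal (w y) \<partial>measure_pmf (pmf_of_set (neighbours G x)))"
        using C[OF x(1)] zero by (intro nn_integral_cong_AE) (auto simp: AE_measure_pmf_iff indicator_def)
      finally show "ennreal (w x) \<le> 1 + (\<integral>\<^sup>+ y. indicator B y * ennreal (w y) \<partial>measure_pmf (pmf_of_set (neighbours G x)))"
        by simp
    qed auto
    also have "\<dots> = ?F t (\<lambda>_. 1) + ?F (Suc t) w"
      by (simp add: killed_mean_Suc killed_mean_add)
    finally show ?thesis .
  qed
  have le: "ennreal (w v) \<le> (\<Sum>t<n. ?F t (\<lambda>_. 1)) + ?F n w" for n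
  proof (induction n)
    case 0
    then show ?case using zero[OF v] by (auto simp: killed_mean_0 indicator_def)
  next
    case (Suc n)
    have "(\<Sum>t<n. ?F t (\<lambda>_. 1)) + ?F n w \<le> (\<Sum>t<n. ?F t (\<lambda>_. 1)) + (?F n (\<lambda>_. 1) + ?F (Suc n) w)"
      by (intro add_left_mono step)
    also have "\<dots> = (\<Sum>t<Suc n. ?F t (\<lambda>_. 1)) + ?F (Suc n) w"
      by (simp add: add.assoc)
    finally show ?case using Suc.IH by order
  qed
  have fin': "(\<Sum>t. ?F t (\<lambda>_. 1)) < \<infinity>"
    using fin by (simp add: mean_exit_time_suminf)
  have lim: "(\<lambda>n. ?F n (\<lambda>_. 1)) \<longlonglongrightarrow> 0"
  proof -
    have "\<forall>n. ?F n (\<lambda>_. 1) < \<infinity>"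
      using fin' by (metis ennreal_suminf_lessD infinity_ennreal_def)
    then have e: "?F n (\<lambda>_. 1) = ennreal (enn2real (?F n (\<lambda>_. 1)))" for n
      by simp
    have "summable (\<lambda>n. enn2real (?F n (\<lambda>_. 1)))"
      using fin' e by (intro summable_suminf_not_top) (auto simp: less_top)
    then have "(\<lambda>n. enn2real (?F n (\<lambda>_. 1))) \<longlonglongrightarrow> 0"
      by (rule summable_LIMSEQ_zero)
    then have "(\<lambda>n. ennreal (enn2real (?F n (\<lambda>_. 1)))) \<longlonglongrightarrow> ennreal 0"
      by (rule tendsto_ennrealI)
    then show ?thesis using e by simp
  qed
  have "(\<lambda>n. (\<Sum>t. ?F t (\<lambda>_. 1)) + ennreal T * ?F n (\<lambda>_. 1)) \<longlonglongrightarrow> (\<Sum>t. ?F t (\<lambda>_. 1)) + ennreal T * 0"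
    by (intro tendsto_add tendsto_const ennreal_tendsto_cmult lim) simp
  moreover have "ennreal (w v) \<le> (\<Sum>t. ?F t (\<lambda>_. 1)) + ennreal T * ?F n (\<lambda>_. 1)" for n
  proof -
    have "?F n w \<le> ?F n (\<lambda>_. ennreal T * 1)"
      by (rule killed_mean_mono[OF v C]) (auto simp: bounded ennreal_leI)
    also have "\<dots> = ennreal T * ?F n (\<lambda>_. 1)"
      by (rule killed_mean_cmult)
    finally show ?thesis
      using le[of n] sum_le_suminf[of "\<lambda>t. ?F t (\<lambda>_. 1)" "{..<n}"]
      by (meson add_mono order_trans summableI finite_lessThan zero_le)
  qed
  ultimately have "ennreal (w v) \<le> (\<Sum>t. ?F t (\<lambda>_. 1)) + ennreal T * 0"
    by (intro LIMSEQ_le_const) auto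
  then show ?thesis by (simp add: mean_exit_time_suminf)
qed

section \<open>The weighted energy estimate\<close>

text \<open>Reversal permutes the ordered adjacent pairs inside \<open>C\<close>. This is the
  reversibility of the walk, used below to symmetrise double sums.\<close>

lemma sum_neighbours_swap:
  fixes g :: "'v \<Rightarrow> 'v \<Rightarrow> real"
  assumes C: "finite C" "\<And>x. x \<in> C \<Longrightarrow> N x \<subseteq> C"
    and sym: "\<And>x y. y \<in> N x \<Longrightarrow> x \<in> N y"
  shows "(\<Sum>x\<in>C. \<Sum>y\<in>N x. g x y) = (\<Sum>x\<in>C. \<Sum>y\<in>N x. g y x)"
proof -
  have N: "N x = {y \<in> C. y \<in> N x}" "N x = {y \<in> C. x \<in> N y}" if "x \<in> C" for x
    using C(2)[OF that] sym by blast+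
  have "(\<Sum>x\<in>C. \<Sum>y\<in>N x. g x y) = (\<Sum>x\<in>C. \<Sum>y\<in>{y \<in> C. y \<in> N x}. g x y)"
    using N(1) by (intro sum.cong) auto
  also have "\<dots> = (\<Sum>y\<in>C. \<Sum>x\<in>{x \<in> C. y \<in> N x}. g x y)"
    by (rule sum.swap_restrict) (use C in auto)
  also have "\<dots> = (\<Sum>x\<in>C. \<Sum>y\<in>N x. g y x)"
    using N(2) by (intro sum.cong) auto
  finally show ?thesis .
qed

text \<open>The function \<open>u\<close> plays the role of the mean of
  \<open>\<theta> ^ \<tau>\<close> but is built as a fixed point of \<open>step\<close>: the
  iterates starting from the constant 1 decrease and stay nonnegative, and their limit passes
  through the neighbour sums.\<close>

lemma discounted_exit_exists:
  fixes \<theta> :: real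
  assumes "0 \<le> \<theta>" "\<theta> \<le> 1"
  obtains u :: "'v \<Rightarrow> real" where "\<And>x. 0 \<le> u x" "\<And>x. u x \<le> 1" "\<And>x. x \<notin> B \<Longrightarrow> u x = 1"
    "\<And>x. x \<in> B \<Longrightarrow> u x = \<theta> * ((\<Sum>y\<in>N x. u y) / card (N x))"
proof -
  define step where "step f x = (if x \<in> B then \<theta> * ((\<Sum>y\<in>N x. f y) / card (N x)) else 1)"
    for f :: "'v \<Rightarrow> real" and x
  define U where "U k = (step ^^ k) (\<lambda>_. 1)" for k
  have U: "U 0 = (\<lambda>_. 1)" "U (Suc k) = step (U k)" for k
    by (simp_all add: U_def)
  have step_mono: "step f x \<le> step g x" if "\<And>x. f x \<le> g x" for f g x
    using that assms by (auto simp: step_def intro!: mult_left_mono divide_right_mono sum_mono)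
  have "U (Suc k) x \<le> U k x \<and> 0 \<le> U k x" for k x
  proof (induction k arbitrary: x)
    case 0
    \<comment> \<open>Also true for empty or infinite \<open>N x\<close>: sum and
      \<open>card\<close> are then 0, and 0 / 0 = 0.\<close>
    have "(\<Sum>y\<in>N x. 1::real) / card (N x) \<le> 1"
      by simp
    then have "\<theta> * ((\<Sum>y\<in>N x. 1::real) / card (N x)) \<le> 1"
      using assms by (intro mult_le_one) auto
    then show ?case
      unfolding U by (simp add: step_def)
  next
    case (Suc k)
    have "step (U (Suc k)) x \<le> step (U k) x"
      by (rule step_mono) (use Suc in auto)
    moreover have "0 \<le> step (U k) x"
      unfolding step_def using Suc assms by (auto intro!: mult_nonneg_nonneg divide_nonneg_nonneg sum_nonneg)
    ultimately show ?case
      by (simp add: U)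
  qed
  then have dec: "decseq (\<lambda>k. U k x)" and nonneg: "0 \<le> U k x" for k x
    by (auto intro: decseq_SucI)
  have "\<exists>L. (\<lambda>k. U k x) \<longlonglongrightarrow> L" for x
    using decseq_convergent[OF dec, of 0 x] nonneg by metis
  then obtain u where u: "\<And>x. (\<lambda>k. U k x) \<longlonglongrightarrow> u x"
    by metis
  have "(\<lambda>k. step (U k) x) \<longlonglongrightarrow> step u x" for x
    unfolding step_def by (auto intro!: tendsto_intros u simp: divide_inverse)
  moreover have "(\<lambda>k. step (U k) x) \<longlonglongrightarrow> u x" for x
    using LIMSEQ_Suc[OF u, of x] by (simp add: U)
  ultimately have fp: "u x = step u x" for x
    using LIMSEQ_unique by blast
  show thesis
  proof (rule that[of u])
    show "0 \<le> u x" for x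
      by (rule LIMSEQ_le_const[OF u]) (use nonneg in auto)
    show "u x \<le> 1" for x
      using decseq_ge[OF dec u, of x 0] by (simp add: U)
    show "x \<notin> B \<Longrightarrow> u x = 1" for x
      by (subst fp) (simp add: step_def)
    show "x \<in> B \<Longrightarrow> u x = \<theta> * ((\<Sum>y\<in>N x. u y) / card (N x))" for x
      by (subst fp) (simp add: step_def)
  qed
qed

text \<open>
  With \<open>h x = exp (\<phi> x) * u x\<close>, multiplying the equation for u by \<open>exp (2 * \<phi> x) * u x\<close> and summing
  gives the left-hand sum as \<open>\<theta>\<close> times a bilinear form in h whose coefficients \<open>exp (\<phi> x - \<phi> y)\<close>
  become \<open>cosh (\<phi> x - \<phi> y)\<close> after symmetrisation.
\<close>

lemma weighted_energy_bound:
  fixes u \<phi> :: "'v \<Rightarrow> real" and \<theta> \<kappa> :: real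
  assumes fin: "finite C" and C: "\<And>x. x \<in> C \<Longrightarrow> N x \<noteq> {} \<and> N x \<subseteq> C"
    and sym: "\<And>x y. y \<in> N x \<Longrightarrow> x \<in> N y"
    and \<theta>: "0 \<le> \<theta>" and lip: "\<And>x y. x \<in> C \<Longrightarrow> y \<in> N x \<Longrightarrow> \<bar>\<phi> x - \<phi> y\<bar> \<le> \<kappa>"
    and nonneg: "\<And>x. 0 \<le> u x"
    and out: "\<And>x. x \<in> C \<Longrightarrow> x \<notin> B \<Longrightarrow> u x = 1 \<and> \<phi> x = 0"
    and eq: "\<And>x. x \<in> C \<Longrightarrow> x \<in> B \<Longrightarrow> u x = \<theta> * ((\<Sum>y\<in>N x. u y) / card (N x))"
  shows "(1 - \<theta> * cosh \<kappa>) * (\<Sum>x\<in>C. card (N x) * (exp (\<phi> x) * u x)\<^sup>2) \<le> (\<Sum>x\<in>C. card (N x))"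
proof -
  define h where "h x = exp (\<phi> x) * u x" for x
  define S where "S = (\<Sum>x\<in>C. card (N x) * (h x)\<^sup>2)"
  have h: "0 \<le> h x" for x
    by (simp add: h_def nonneg)
  have finN: "finite (N x)" if "x \<in> C" for x
    using C[OF that] fin finite_subset by blast
  have local_ineq: "card (N x) * (h x)\<^sup>2 \<le> \<theta> * (\<Sum>y\<in>N x. exp (\<phi> x - \<phi> y) * (h x * h y)) + card (N x)"
    if x: "x \<in> C" for x
  proof (cases "x \<in> B")
    case True
    have "card (N x) > 0"
      using C[OF x] finN[OF x] by (simp add: card_gt_0_iff)
    then have "card (N x) * u x = \<theta> * (\<Sum>y\<in>N x. u y)"
      using eq[OF x True] by (simp add: field_simps)
    then have "card (N x) * (h x)\<^sup>2 = exp (\<phi> x) * h x * (\<theta> * (\<Sum>y\<in>N x. u y))"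
      by (simp add: h_def power2_eq_square mult.assoc mult.left_commute)
    also have "\<dots> = \<theta> * (\<Sum>y\<in>N x. exp (\<phi> x) * h x * u y)"
      by (simp add: sum_distrib_left mult_ac)
    also have "(\<Sum>y\<in>N x. exp (\<phi> x) * h x * u y) = (\<Sum>y\<in>N x. exp (\<phi> x - \<phi> y) * (h x * h y))"
      by (intro sum.cong refl) (simp add: h_def exp_diff)
    finally show ?thesis by simp
  next
    case False
    then have "h x = 1"
      using out[OF x] by (simp add: h_def)
    then show ?thesis
      using \<theta> h by (simp add: sum_nonneg)
  qed
  have pair: "exp (\<phi> x - \<phi> y) * (h x * h y) + exp (\<phi> y - \<phi> x) * (h y * h x) \<le> cosh \<kappa> * ((h x)\<^sup>2 + (h y)\<^sup>2)"
    if "x \<in> C" "y \<in> N x" for x y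
  proof -
    have "exp (\<phi> x - \<phi> y) * (h x * h y) + exp (\<phi> y - \<phi> x) * (h y * h x) = cosh (\<phi> x - \<phi> y) * (2 * h x * h y)"
      by (simp add: cosh_def algebra_simps)
    also have "\<dots> = cosh \<bar>\<phi> x - \<phi> y\<bar> * (2 * h x * h y)"
      by (simp add: cosh_real_abs)
    also have "\<dots> \<le> cosh \<kappa> * (2 * h x * h y)"
      using lip[OF that] h by (intro mult_right_mono cosh_real_nonneg_le_iff[THEN iffD2]) auto
    also have "\<dots> \<le> cosh \<kappa> * ((h x)\<^sup>2 + (h y)\<^sup>2)"
      using sum_squares_bound[of "h x" "h y"] by (intro mult_left_mono) auto
    finally show ?thesis .
  qed
  let ?D = "\<Sum>x\<in>C. \<Sum>y\<in>N x. exp (\<phi> x - \<phi> y) * (h x * h y)"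
  have sq: "(\<Sum>x\<in>C. \<Sum>y\<in>N x. (h x)\<^sup>2) = S"
    by (simp add: S_def)
  have sq': "(\<Sum>x\<in>C. \<Sum>y\<in>N x. (h y)\<^sup>2) = S"
    using sum_neighbours_swap[of C N "\<lambda>x y. (h y)\<^sup>2"] fin C sym sq by auto
  have "2 * ?D = (\<Sum>x\<in>C. \<Sum>y\<in>N x. exp (\<phi> x - \<phi> y) * (h x * h y) + exp (\<phi> y - \<phi> x) * (h y * h x))"
    using sum_neighbours_swap[of C N "\<lambda>x y. exp (\<phi> x - \<phi> y) * (h x * h y)"] fin C sym
    by (simp add: sum.distrib)
  also have "\<dots> \<le> (\<Sum>x\<in>C. \<Sum>y\<in>N x. cosh \<kappa> * ((h x)\<^sup>2 + (h y)\<^sup>2))"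
    by (intro sum_mono pair)
  also have "\<dots> = cosh \<kappa> * (2 * S)"
    using sq sq' by (simp add: sum_distrib_left[symmetric] sum.distrib)
  finally have D: "?D \<le> cosh \<kappa> * S"
    by simp
  have "S \<le> (\<Sum>x\<in>C. \<theta> * (\<Sum>y\<in>N x. exp (\<phi> x - \<phi> y) * (h x * h y)) + card (N x))"
    unfolding S_def by (intro sum_mono local_ineq)
  also have "\<dots> = \<theta> * ?D + (\<Sum>x\<in>C. card (N x))"
    by (simp add: sum.distrib sum_distrib_left)
  also have "\<dots> \<le> \<theta> * (cosh \<kappa> * S) + (\<Sum>x\<in>C. card (N x))"
    using \<theta> D by (intro add_right_mono mult_left_mono)
  finally show ?thesis
    by (simp add: S_def h_def algebra_simps)
qed

lemma cosh_le_quadratic: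
  fixes x :: real
  assumes "0 \<le> x" "x \<le> 1"
  shows "cosh x \<le> 1 + x\<^sup>2"
proof -
  \<comment> \<open>The product is at least 1, so \<open>1 - x + x\<^sup>2\<close> dominates the
    reciprocal of a lower bound of \<open>exp x\<close>, hence \<open>exp (- x)\<close>.\<close>
  have "(1 - x + x\<^sup>2) * (1 + x + x\<^sup>2 / 2) = 1 + x\<^sup>2 / 2 + x ^ 3 / 2 + x ^ 4 / 2"
    by (simp add: field_simps power2_eq_square power3_eq_cube power4_eq_xxxx)
  then have "1 \<le> (1 - x + x\<^sup>2) * (1 + x + x\<^sup>2 / 2)"
    using assms by simp
  also have "\<dots> \<le> (1 - x + x\<^sup>2) * exp x"
    using exp_lower_Taylor_quadratic[OF assms(1)] assms by (intro mult_left_mono) auto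
  finally have "exp (- x) \<le> 1 - x + x\<^sup>2"
    by (simp add: exp_minus field_simps)
  then show ?thesis
    using exp_bound[OF assms] by (simp add: cosh_def)
qed

text \<open>Here \<delta> is the distance from \<open>v\<close>. The volume condition is what the
  energy estimate needs to give \<open>u v \<le> 1/2\<close>; then at least half of the mass of
  \<open>1 - u v\<close> is left, and dividing by \<open>1 - \<theta> = 2 * \<kappa>\<^sup>2\<close>
  yields the bound.\<close>

lemma mean_exit_time_lower_bound:
  fixes \<delta> :: "'v \<Rightarrow> real" and r \<kappa> :: real
  assumes fin: "finite C" and v: "v \<in> C"
    and C: "\<And>x. x \<in> C \<Longrightarrow> neighbours G x \<noteq> {} \<and> neighbours G x \<subseteq> C"
    and sym: "\<And>x y. y \<in> neighbours G x \<Longrightarrow> x \<in> neighbours G y"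
    and lip: "\<And>x y. x \<in> C \<Longrightarrow> y \<in> neighbours G x \<Longrightarrow> \<delta> y \<le> \<delta> x + 1"
    and \<delta>v: "\<delta> v = 0" and B: "\<And>x. x \<in> C \<Longrightarrow> x \<in> B \<longleftrightarrow> \<delta> x < r"
    and r: "0 \<le> r" and \<kappa>: "0 < \<kappa>" "\<kappa> \<le> 1 / 2"
    and vol: "4 * (\<Sum>x\<in>C. card (neighbours G x)) \<le> \<kappa>\<^sup>2 * exp (2 * \<kappa> * r)"
    and finite_exit: "mean_exit_time G v B < \<infinity>"
  shows "ennreal (1 / (4 * \<kappa>\<^sup>2)) \<le> mean_exit_time G v B"
proof -
  let ?N = "neighbours G"
  define \<theta> where "\<theta> = 1 - 2 * \<kappa>\<^sup>2"
  have "\<kappa>\<^sup>2 \<le> (1 / 2)\<^sup>2"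
    using \<kappa> by (intro power_mono) auto
  then have \<theta>: "0 \<le> \<theta>" "\<theta> \<le> 1"
    by (auto simp: \<theta>_def power2_eq_square)
  obtain u where u: "\<And>x. 0 \<le> u x" "\<And>x. u x \<le> 1" "\<And>x. x \<notin> B \<Longrightarrow> u x = 1"
    "\<And>x. x \<in> B \<Longrightarrow> u x = \<theta> * ((\<Sum>y\<in>?N x. u y) / card (?N x))"
    using discounted_exit_exists[OF \<theta>] by metis
  \<comment> \<open>Vanishes outside \<open>B\<close>, changes by at most \<kappa> along an edge,
    and equals \<open>\<kappa> * r\<close> at \<open>v\<close>.\<close>
  define \<phi> where "\<phi> x = \<kappa> * max 0 (r - \<delta> x)" for x
  have finN: "finite (?N x)" if "x \<in> C" for x
    using C[OF that] fin finite_subset by blast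
  have card_pos: "1 \<le> real (card (?N x))" if "x \<in> C" for x
    using C[OF that] finN[OF that] by (simp add: Suc_le_eq card_gt_0_iff)
  have "\<bar>\<phi> x - \<phi> y\<bar> \<le> \<kappa>" if "x \<in> C" "y \<in> ?N x" for x y
  proof -
    have "\<bar>max 0 (r - \<delta> x) - max 0 (r - \<delta> y)\<bar> \<le> 1"
      using lip[OF that] lip[of y x] sym[OF that(2)] C[OF that(1)] that(2) by (auto simp: max_def)
    then have "\<kappa> * \<bar>max 0 (r - \<delta> x) - max 0 (r - \<delta> y)\<bar> \<le> \<kappa> * 1"
      using \<kappa> by (intro mult_left_mono) auto
    then show ?thesis
      using \<kappa> by (simp add: \<phi>_def abs_mult flip: right_diff_distrib)
  qed
  then have energy: "(1 - \<theta> * cosh \<kappa>) * (\<Sum>x\<in>C. card (?N x) * (exp (\<phi> x) * u x)\<^sup>2) \<le> (\<Sum>x\<in>C. card (?N x))"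
    using \<theta> u C sym B by (intro weighted_energy_bound[where B = B] fin) (auto simp: \<phi>_def)
  \<comment> \<open>This is why 1 - \<theta> is twice \<open>\<kappa>\<^sup>2\<close>: one half pays
    for the growth of cosh, the other half remains as the gap.\<close>
  have "\<theta> * cosh \<kappa> \<le> \<theta> * (1 + \<kappa>\<^sup>2)"
    using \<theta> \<kappa> by (intro mult_left_mono cosh_le_quadratic) auto
  also have "\<dots> \<le> 1 - \<kappa>\<^sup>2"
    by (simp add: \<theta>_def algebra_simps)
  finally have gap: "\<kappa>\<^sup>2 \<le> 1 - \<theta> * cosh \<kappa>"
    by simp
  then have gap': "0 \<le> 1 - \<theta> * cosh \<kappa>"
    using zero_le_power2 order_trans by blast
  \<comment> \<open>Of the energy only the term at \<open>v\<close>, where the weight is largest, is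
    kept; the degree there is at least 1.\<close>
  have "(exp (\<kappa> * r) * u v)\<^sup>2 \<le> card (?N v) * (exp (\<phi> v) * u v)\<^sup>2"
    using mult_right_mono[OF card_pos[OF v], of "(exp (\<kappa> * r) * u v)\<^sup>2"] r by (simp add: \<phi>_def \<delta>v max_def)
  also have "\<dots> \<le> (\<Sum>x\<in>C. card (?N x) * (exp (\<phi> x) * u x)\<^sup>2)"
    using fin v by (intro member_le_sum) auto
  finally have "\<kappa>\<^sup>2 * (exp (\<kappa> * r) * u v)\<^sup>2 \<le> (1 - \<theta> * cosh \<kappa>) * (\<Sum>x\<in>C. card (?N x) * (exp (\<phi> x) * u x)\<^sup>2)"
    by (intro mult_mono gap gap') auto
  also have "\<dots> \<le> \<kappa>\<^sup>2 * exp (2 * \<kappa> * r) / 4"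
    using energy vol by simp
  also have "exp (2 * \<kappa> * r) = (exp (\<kappa> * r))\<^sup>2"
    by (simp add: exp_double[symmetric] mult.assoc)
  finally have "\<kappa>\<^sup>2 * (exp (\<kappa> * r))\<^sup>2 * (u v)\<^sup>2 \<le> \<kappa>\<^sup>2 * (exp (\<kappa> * r))\<^sup>2 * (1 / 2)\<^sup>2"
    by (simp add: power2_eq_square mult_ac)
  then have "(u v)\<^sup>2 \<le> (1 / 2)\<^sup>2"
    using \<kappa> by simp
  then have uv: "u v \<le> 1 / 2"
    by (rule power2_le_imp_le) simp
  \<comment> \<open>Reflects \<open>1 - \<theta> ^ \<tau> \<le> (1 - \<theta>) * \<tau>\<close>. In
    \<open>B\<close>, \<open>w x\<close> is the neighbour average of \<open>w\<close> plus that of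
    \<open>u\<close>, and the latter is at most 1; outside \<open>B\<close>, \<open>w\<close> is
    0.\<close>
  define w where "w x = (1 - u x) / (2 * \<kappa>\<^sup>2)" for x
  have "ennreal (w v) \<le> mean_exit_time G v B"
  proof (rule mean_exit_time_ge[where C = C and T = "1 / (2 * \<kappa>\<^sup>2)"])
    fix x assume x: "x \<in> C" "x \<in> B"
    let ?a = "(\<Sum>y\<in>?N x. u y) / card (?N x)"
    have "(\<Sum>y\<in>?N x. w y) = (card (?N x) - (\<Sum>y\<in>?N x. u y)) / (2 * \<kappa>\<^sup>2)"
      by (simp add: w_def sum_divide_distrib[symmetric] sum_subtractf)
    then have a: "(\<Sum>y\<in>?N x. w y) / card (?N x) = (1 - ?a) / (2 * \<kappa>\<^sup>2)"
      using card_pos[OF x(1)] by (simp add: field_simps)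
    have "(\<Sum>y\<in>?N x. u y) \<le> card (?N x)"
      using sum_bounded_above[of "?N x" u 1] u by simp
    then have "?a \<le> 1"
      using card_pos[OF x(1)] by simp
    moreover have "(1 - (1 - 2 * \<kappa>\<^sup>2) * a) / (2 * \<kappa>\<^sup>2) = (1 - a) / (2 * \<kappa>\<^sup>2) + a" for a
      using \<kappa> by (simp add: field_simps)
    then have "w x = (1 - ?a) / (2 * \<kappa>\<^sup>2) + ?a"
      unfolding w_def u(4)[OF x(2)] \<theta>_def .
    ultimately show "w x \<le> 1 + (\<Sum>y\<in>?N x. w y) / card (?N x)"
      by (simp add: a)
  qed (use v C finN finite_exit u in \<open>auto simp: w_def divide_right_mono\<close>)
  moreover have "1 / (4 * \<kappa>\<^sup>2) \<le> w v"
    using uv \<kappa> by (simp add: w_def field_simps)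
  ultimately show ?thesis
    by (meson ennreal_leI order_trans)
qed

section \<open>Exit times from balls\<close>

text \<open>Think of \<open>s x\<close> as the distance from x to a fixed vertex outside B.\<close>

lemma mean_exit_time_finite_if_exit_reachable:
  fixes s :: "'v \<Rightarrow> nat"
  assumes fin: "finite C" and v: "v \<in> C"
    and C: "\<And>x. x \<in> C \<Longrightarrow> neighbours G x \<noteq> {} \<and> neighbours G x \<subseteq> C"
    and s: "\<And>x. x \<in> C \<Longrightarrow> x \<in> B \<Longrightarrow> \<exists>y \<in> neighbours G x. s x = Suc (s y)"
  shows "mean_exit_time G v B < \<infinity>"
proof -
  let ?N = "neighbours G"
  have finN: "finite (?N x)" if "x \<in> C" for x
    using C[OF that] fin finite_subset by blast
  have card_pos: "1 \<le> card (?N x)" if "x \<in> C" for x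
    using C[OF that] finN[OF that] by (simp add: Suc_le_eq card_gt_0_iff)
  define m where "m = (\<Sum>x\<in>C. card (?N x))"
  \<comment> \<open>An upper bound for s, so that the natural subtraction \<open>D - s x\<close>
    never truncates.\<close>
  define D where "D = (\<Sum>x\<in>C. s x)"
  define M where "M = 2 * real m"
  have sD: "s x \<le> D" if "x \<in> C" for x
    unfolding D_def using that fin by (intro member_le_sum) auto
  have m: "card (?N x) \<le> m" if "x \<in> C" for x
    unfolding m_def using that fin by (intro member_le_sum) auto
  then have M: "1 \<le> M"
    using card_pos[OF v] m[OF v] by (simp add: M_def)
  show ?thesis
  \<comment> \<open>The base M is at least twice every degree. Hence the one neighbour closer to the
    exit already makes the average of \<open>M ^ (D - s y)\<close> at least twice
    \<open>M ^ (D - s x)\<close>, an increase by at least 1.\<close>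
  proof (rule mean_exit_time_finite[where C = C and g = "\<lambda>x. M ^ D - M ^ (D - s x)"])
    fix x assume x: "x \<in> C" "x \<in> B"
    obtain y where y: "y \<in> ?N x" "s x = Suc (s y)"
      using s[OF x] by blast
    let ?n = "real (card (?N x))"
    have n: "0 < ?n"
      using card_pos[OF x(1)] by simp
    have "D - s y = Suc (D - s x)"
      using y sD[OF x(1)] by simp
    then have "2 * ?n * M ^ (D - s x) \<le> M ^ (D - s y)"
      using m[OF x(1)] M by (simp add: M_def mult_right_mono)
    also have "\<dots> \<le> (\<Sum>y\<in>?N x. M ^ (D - s y))"
      using y finN[OF x(1)] M by (intro member_le_sum) auto
    finally have "2 * M ^ (D - s x) \<le> (\<Sum>y\<in>?N x. M ^ (D - s y)) / ?n"
      using n by (simp add: field_simps)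
    moreover have "(\<Sum>y\<in>?N x. M ^ D - M ^ (D - s y)) / ?n = M ^ D - (\<Sum>y\<in>?N x. M ^ (D - s y)) / ?n"
      using n by (simp add: sum_subtractf diff_divide_distrib)
    moreover have "1 \<le> M ^ (D - s x)"
      using M by (rule one_le_power)
    ultimately show "1 + (\<Sum>y\<in>?N x. M ^ D - M ^ (D - s y)) / ?n \<le> M ^ D - M ^ (D - s x)"
      by simp
    next
    show "0 \<le> M ^ D - M ^ (D - s x)" for x
      using M by (simp add: power_increasing)
  qed (use v C finN in auto)
qed

section \<open>Graph distance through powers of the adjacency relation\<close>

lemma arcs_undirected:
  "arcs (undirected G) = (\<Union>e\<in>arcs G. {(tail G e, head G e), (head G e, tail G e)})"
  by (simp add: undirected_def parcs_mk_symmetric)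

lemma sym_arcs_undirected: "sym (arcs (undirected G))"
  by (auto simp: arcs_undirected sym_def)

text \<open>Walks in the undirected graph are lists of vertex pairs, so walks of length l correspond
  to the l-th relational power. The induction drops the condition that the start is a vertex, which
  \<open>awalk\<close> demands.\<close>

lemma gdist_relpow:
  assumes "u \<in> verts G"
  shows "gdist G u v = (LEAST l. (u, v) \<in> arcs (undirected G) ^^ l)"
proof -
  have "(\<exists>p. set p \<subseteq> arcs (undirected G) \<and> pre_digraph.cas (undirected G) x p v \<and> length p = l) \<longleftrightarrow>
      (x, v) \<in> arcs (undirected G) ^^ l" for x l
  proof (induction l arbitrary: x)
    case 0
    then show ?case
      by (simp add: pre_digraph.cas.simps)
  next
    case (Suc l)
    have "(\<exists>p. set p \<subseteq> arcs (undirected G) \<and> pre_digraph.cas (undirected G) x p v \<and> length p = Suc l) \<longleftrightarrow>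
        (\<exists>y. (x, y) \<in> arcs (undirected G) \<and>
          (\<exists>p. set p \<subseteq> arcs (undirected G) \<and> pre_digraph.cas (undirected G) y p v \<and> length p = l))"
    proof (intro iffI; elim exE conjE)
      fix p assume p: "set p \<subseteq> arcs (undirected G)" "pre_digraph.cas (undirected G) x p v" "length p = Suc l"
      then obtain e q where "p = e # q"
        by (cases p) auto
      with p show "\<exists>y. (x, y) \<in> arcs (undirected G) \<and>
          (\<exists>p. set p \<subseteq> arcs (undirected G) \<and> pre_digraph.cas (undirected G) y p v \<and> length p = l)"
        by (intro exI[of _ "snd e"] exI[of _ q] conjI) (auto simp: pre_digraph.cas.simps undirected_def)
    next
      fix y p assume "(x, y) \<in> arcs (undirected G)" "set p \<subseteq> arcs (undirected G)"
        "pre_digraph.cas (undirected G) y p v" "length p = l"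
      then show "\<exists>p. set p \<subseteq> arcs (undirected G) \<and> pre_digraph.cas (undirected G) x p v \<and> length p = Suc l"
        by (intro exI[of _ "(x, y) # p"]) (simp add: pre_digraph.cas.simps undirected_def)
    qed
    also have "\<dots> \<longleftrightarrow> (x, v) \<in> arcs (undirected G) ^^ Suc l"
      unfolding Suc.IH by (metis relpow_Suc_I2 relpow_Suc_D2)
    finally show ?case .
  qed
  then show ?thesis
    using assms by (simp add: gdist_def pre_digraph.awalk_def undirected_def)
qed

lemma gdist_self: "v \<in> verts G \<Longrightarrow> gdist G v v = 0"
  by (simp add: gdist_relpow)

lemma gdist_walk:
  assumes "u \<in> verts G" "(u, v) \<in> (arcs (undirected G))\<^sup>*"
  shows "(u, v) \<in> arcs (undirected G) ^^ gdist G u v"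
  unfolding gdist_relpow[OF assms(1)] by (rule LeastI_ex) (use assms(2) in \<open>simp add: rtrancl_power\<close>)

lemma gdist_Suc_le:
  assumes "u \<in> verts G" "(u, v) \<in> (arcs (undirected G))\<^sup>*" "(v, w) \<in> arcs (undirected G)"
  shows "gdist G u w \<le> Suc (gdist G u v)"
  unfolding gdist_relpow[OF assms(1), of w] using gdist_walk[OF assms(1,2)] assms(3)
  by (intro Least_le relpow_Suc_I)

text \<open>The second vertex of a shortest walk is exactly one step closer to \<open>z\<close>: the
  rest of the walk bounds its distance from above, and prepending the first step to a shortest walk
  bounds it from below.\<close>

lemma gdist_first_step:
  assumes G: "wf_digraph G" and u: "u \<in> verts G" "(u, z) \<in> (arcs (undirected G))\<^sup>*" "u \<noteq> z"
  shows "\<exists>y. (u, y) \<in> arcs (undirected G) \<and> gdist G u z = Suc (gdist G y z)"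
proof -
  obtain k where k: "gdist G u z = Suc k"
    using gdist_walk[OF u(1,2)] u(3) by (cases "gdist G u z") auto
  then obtain y where y: "(u, y) \<in> arcs (undirected G)" "(y, z) \<in> arcs (undirected G) ^^ k"
    using gdist_walk[OF u(1,2)] by (metis relpow_Suc_D2)
  have yV: "y \<in> verts G"
    using y(1) G by (auto simp: arcs_undirected wf_digraph_def)
  have "gdist G y z \<le> k"
    unfolding gdist_relpow[OF yV] by (rule Least_le) (rule y)
  moreover have "(y, z) \<in> arcs (undirected G) ^^ gdist G y z"
    by (rule gdist_walk[OF yV]) (use y(2) in \<open>auto simp: rtrancl_power\<close>)
  then have "gdist G u z \<le> Suc (gdist G y z)"
    unfolding gdist_relpow[OF u(1)] by (intro Least_le relpow_Suc_I2[OF y(1)])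
  ultimately show ?thesis
    using y(1) k by (intro exI[of _ y]) simp
qed

text \<open>The vertex \<open>z\<close> witnesses that the ball can be left. The factor 8 is the 4
  of the volume condition times 2, since each arc yields at most two ordered adjacent pairs.\<close>

lemma ball_mean_exit_time:
  fixes r \<kappa> :: real
  assumes G: "wf_digraph G" "finite (verts G)" "finite (arcs G)"
    and v: "v \<in> verts G" and z: "(v, z) \<in> (arcs (undirected G))\<^sup>*" "v \<noteq> z" "r \<le> gdist G v z"
    and r: "0 \<le> r" and \<kappa>: "0 < \<kappa>" "\<kappa> \<le> 1 / 2"
    and vol: "8 * real (card (arcs G)) \<le> \<kappa>\<^sup>2 * exp (2 * \<kappa> * r)"
  shows "mean_exit_time G v (gball G v r) < \<infinity>"
    and "ennreal (1 / (4 * \<kappa>\<^sup>2)) \<le> mean_exit_time G v (gball G v r)"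
proof -
  let ?E = "arcs (undirected G)" and ?B = "gball G v r" and ?N = "neighbours G"
  \<comment> \<open>The component of \<open>v\<close> is closed under neighbours, and within it all
    distances from \<open>v\<close> and to \<open>z\<close> are realised by walks.\<close>
  define C where "C = {x. (v, x) \<in> ?E\<^sup>*}"
  have E: "?E \<subseteq> verts G \<times> verts G"
    using G(1) by (auto simp: arcs_undirected wf_digraph_def)
  have symE: "(y, x) \<in> ?E" if "(x, y) \<in> ?E" for x y
    using sym_arcs_undirected that by (rule symD)
  have sym_star: "(y, x) \<in> ?E\<^sup>*" if "(x, y) \<in> ?E\<^sup>*" for x y
    using sym_rtrancl[OF sym_arcs_undirected] that by (rule symD)
  have C_verts: "C \<subseteq> verts G"
  proof
    fix x assume "x \<in> C"
    then have "(v, x) \<in> ?E\<^sup>*" by (simp add: C_def)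
    then show "x \<in> verts G"
      by cases (use v E in auto)
  qed
  then have finC: "finite C"
    using G(2) finite_subset by blast
  have vC: "v \<in> C"
    by (simp add: C_def)
  have N: "?N x \<noteq> {} \<and> ?N x \<subseteq> C" if "x \<in> C" for x
  proof
    have vx: "(v, x) \<in> ?E\<^sup>*"
      using that by (simp add: C_def)
    \<comment> \<open>At least one of \<open>v\<close> and \<open>z\<close> differs from
      \<open>x\<close>, and a walk towards it must leave \<open>x\<close>.\<close>
    obtain y where "x \<noteq> y" "(x, y) \<in> ?E\<^sup>*"
      using z(1,2) sym_star[OF vx] by metis
    then obtain y' where "(x, y') \<in> ?E"
      by (meson converse_rtranclE)
    then show "?N x \<noteq> {}"
      by (auto simp: neighbours_def)
    show "?N x \<subseteq> C"
      using vx by (auto simp: neighbours_def C_def intro: rtrancl_into_rtrancl)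
  qed
  have reach: "(x, z) \<in> ?E\<^sup>*" if "x \<in> C" for x
    using rtrancl_trans[OF sym_star z(1)] that by (simp add: C_def)
  have zB: "z \<notin> ?B"
    using z(3) by (simp add: gball_def)
  show fin: "mean_exit_time G v ?B < \<infinity>"
  proof (rule mean_exit_time_finite_if_exit_reachable[where C = C and s = "\<lambda>x. gdist G x z"])
    fix x assume x: "x \<in> C" "x \<in> ?B"
    then have "x \<noteq> z"
      using zB by blast
    then show "\<exists>y\<in>?N x. gdist G x z = Suc (gdist G y z)"
      using gdist_first_step[OF G(1) subsetD[OF C_verts x(1)] reach[OF x(1)]] by (simp add: neighbours_def)
  qed (fact finC vC N)+
  have "finite ?E"
    using G(3) by (simp add: arcs_undirected)
  have "(\<Sum>x\<in>C. card (?N x)) = card (SIGMA x:C. ?N x)"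
    using N by (intro card_SigmaI[symmetric] finC ballI) (metis finite_subset finC)
  also have "\<dots> \<le> card ?E"
    by (rule card_mono[OF \<open>finite ?E\<close>]) (auto simp: neighbours_def)
  also have "\<dots> \<le> (\<Sum>e\<in>arcs G. card {(tail G e, head G e), (head G e, tail G e)})"
    unfolding arcs_undirected by (rule card_UN_le[OF G(3)])
  also have "\<dots> \<le> (\<Sum>e\<in>arcs G. 2)"
    using card_length[of "[(tail G e, head G e), (head G e, tail G e)]" for e] by (intro sum_mono) (simp add: numeral_2_eq_2)
  also have "\<dots> = 2 * card (arcs G)"
    by simp
  finally have "real (\<Sum>x\<in>C. card (?N x)) \<le> real (2 * card (arcs G))"
    by (rule of_nat_mono)
  then have "4 * real (\<Sum>x\<in>C. card (?N x)) \<le> 8 * real (card (arcs G))"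
    by simp
  also note vol
  finally have vol': "4 * real (\<Sum>x\<in>C. card (?N x)) \<le> \<kappa>\<^sup>2 * exp (2 * \<kappa> * r)" .
  show "ennreal (1 / (4 * \<kappa>\<^sup>2)) \<le> mean_exit_time G v ?B"
  proof (rule mean_exit_time_lower_bound[where C = C and \<delta> = "\<lambda>x. real (gdist G v x)" and r = r])
    show "x \<in> ?B \<longleftrightarrow> real (gdist G v x) < r" if "x \<in> C" for x
      using that C_verts by (auto simp: gball_def)
    show "real (gdist G v y) \<le> real (gdist G v x) + 1" if "x \<in> C" "y \<in> ?N x" for x y
      using gdist_Suc_le[OF v, of x y] that by (simp add: C_def neighbours_def)
    show "real (gdist G v v) = 0"
      by (simp add: gdist_self v)
    show "x \<in> ?N y" if "y \<in> ?N x" for x y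
      using that symE by (simp add: neighbours_def)
    show "real (4 * (\<Sum>x\<in>C. card (?N x))) \<le> \<kappa>\<^sup>2 * exp (2 * \<kappa> * r)"
      using vol' by simp
  qed (fact finC vC N fin r \<kappa>)+
qed

section \<open>The graphs of an edge iterated graph system\<close>

text \<open>Keeps the colours that \<open>Xi\<close> forgets; the next replacement depends on
  them.\<close>

definition eigs_iterate :: "('a, 'e) eigs \<Rightarrow> nat \<Rightarrow> ('a, 'e) xi_graph" where
  "eigs_iterate S n = (replace_edges S ^^ n) (single_edge (init_col S))"

text \<open>A crude growth factor per step. Any exponential bound on the number of edges suffices,
  so the sum over all colours serves as a common bound for the rule graphs.\<close>

definition rule_arc_count :: "('a, 'e) eigs \<Rightarrow> nat" where
  "rule_arc_count S = (\<Sum>i<ncol S. card (arcs (rule S i)))"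

section \<open>Finiteness, connection of the ends and edge growth under replacement\<close>

lemma fin_digraph_rule:
  assumes "is_eigs S" "i < ncol S"
  shows "fin_digraph (rule S i)"
  using assms by (auto simp: is_eigs_def simple_undirected_def digraph_def)

lemma rule_planting_connected:
  assumes "is_eigs S" "i < ncol S"
  shows "(plant_pos S i, plant_neg S i) \<in> (arcs (undirected (rule S i)))\<^sup>*"
proof -
  have "Digraph_Component.connected (rule S i)" "plant_pos S i \<in> verts (rule S i)" "plant_neg S i \<in> verts (rule S i)"
    using assms by (auto simp: is_eigs_def)
  then show ?thesis
    by (auto simp: Digraph_Component.connected_def strongly_connected_def reachable_def undirected_def
        intro: rtrancl_on_rtranclI)
qed

lemma replace_edges_simps:
  "verts (gr (replace_edges S G)) = verts (gr G) \<union>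
     {planted S G w x | w x. w \<in> arcs (gr G) \<and> x \<in> verts (rule S (ecol G w))}"
  "arcs (gr (replace_edges S G)) = {e # w | e w. w \<in> arcs (gr G) \<and> e \<in> arcs (rule S (ecol G w))}"
  "tail (gr (replace_edges S G)) (e # w) = planted S G w (tail (rule S (ecol G w)) e)"
  "head (gr (replace_edges S G)) (e # w) = planted S G w (head (rule S (ecol G w)) e)"
  "ecol (replace_edges S G) (e # w) = ecol (rule_graph S (ecol G w)) e"
  by (simp_all add: replace_edges_def)

lemma planted_arc:
  assumes "w \<in> arcs (gr G)" "(x, y) \<in> arcs (undirected (rule S (ecol G w)))"
  shows "(planted S G w x, planted S G w y) \<in> arcs (undirected (gr (replace_edges S G)))"
proof -
  obtain e where e: "e \<in> arcs (rule S (ecol G w))"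
    "(x, y) = (tail (rule S (ecol G w)) e, head (rule S (ecol G w)) e) \<or>
     (x, y) = (head (rule S (ecol G w)) e, tail (rule S (ecol G w)) e)"
    using assms(2) by (auto simp: arcs_undirected)
  then have "e # w \<in> arcs (gr (replace_edges S G))"
    using assms(1) by (auto simp: replace_edges_simps)
  then show ?thesis
    unfolding arcs_undirected using e(2)
    by (intro UN_I[of "e # w"]) (auto simp: replace_edges_simps)
qed

text \<open>Each old edge is replaced by a rule graph in which the planting vertices are joined by a
  walk, and \<open>planted\<close> carries that walk to one between the old endpoints.\<close>

lemma replace_edges_connects:
  assumes S: "is_eigs S" and col: "\<And>w. w \<in> arcs (gr G) \<Longrightarrow> ecol G w < ncol S"
    and xy: "(x, y) \<in> (arcs (undirected (gr G)))\<^sup>*"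
  shows "(x, y) \<in> (arcs (undirected (gr (replace_edges S G))))\<^sup>*"
proof -
  let ?E = "arcs (undirected (gr (replace_edges S G)))"
  have arc: "(tail (gr G) w, head (gr G) w) \<in> ?E\<^sup>*" if w: "w \<in> arcs (gr G)" for w
  proof -
    let ?i = "ecol G w"
    have i: "?i < ncol S"
      by (rule col[OF w])
    have "(planted S G w a, planted S G w b) \<in> ?E\<^sup>*"
      if "(a, b) \<in> (arcs (undirected (rule S ?i)))\<^sup>*" for a b
      using that by induction (auto intro: rtrancl_into_rtrancl planted_arc[OF w])
    \<comment> \<open>\<open>planted\<close> tests for the positive planting vertex first, so
      distinctness is what sends the negative one to the head.\<close>
    moreover have "plant_neg S ?i \<noteq> plant_pos S ?i"
      using S i by (auto simp: is_eigs_def)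
    ultimately show ?thesis
      using rule_planting_connected[OF S i] by (fastforce simp: planted_def)
  qed
  have "sym (?E\<^sup>*)"
    by (rule sym_rtrancl[OF sym_arcs_undirected])
  then have "(a, b) \<in> ?E\<^sup>*" if "(a, b) \<in> arcs (undirected (gr G))" for a b
    using that arc by (auto simp: arcs_undirected dest: symD)
  then have "arcs (undirected (gr G)) \<subseteq> ?E\<^sup>*"
    by auto
  then show ?thesis
    using xy rtrancl_subset_rtrancl by blast
qed

lemma replace_edges_wf:
  assumes S: "is_eigs S" and G: "fin_digraph (gr G)" and col: "\<And>w. w \<in> arcs (gr G) \<Longrightarrow> ecol G w < ncol S"
  shows "fin_digraph (gr (replace_edges S G))"
    and "\<And>w. w \<in> arcs (gr (replace_edges S G)) \<Longrightarrow> ecol (replace_edges S G) w < ncol S"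
    and "card (arcs (gr (replace_edges S G))) \<le> rule_arc_count S * card (arcs (gr G))"
proof -
  interpret G: fin_digraph "gr G" by fact
  have rule: "fin_digraph (rule S (ecol G w))" if "w \<in> arcs (gr G)" for w
    using fin_digraph_rule[OF S col[OF that]] .
  have V: "{planted S G w x | w x. w \<in> arcs (gr G) \<and> x \<in> verts (rule S (ecol G w))} =
      (\<lambda>(w, x). planted S G w x) ` (SIGMA w:arcs (gr G). verts (rule S (ecol G w)))"
    by auto
  have A: "arcs (gr (replace_edges S G)) = (\<lambda>(w, e). e # w) ` (SIGMA w:arcs (gr G). arcs (rule S (ecol G w)))"
    by (auto simp: replace_edges_simps)
  have finV: "finite (verts (rule S (ecol G w)))" and finA: "finite (arcs (rule S (ecol G w)))"
    if "w \<in> arcs (gr G)" for w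
    using rule[OF that] by (auto intro: fin_digraph.finite_verts fin_digraph.finite_arcs)
  show "fin_digraph (gr (replace_edges S G))"
  proof
    fix f assume "f \<in> arcs (gr (replace_edges S G))"
    then obtain e w where f: "f = e # w" "w \<in> arcs (gr G)" "e \<in> arcs (rule S (ecol G w))"
      by (auto simp: A)
    then have "tail (rule S (ecol G w)) e \<in> verts (rule S (ecol G w))" "head (rule S (ecol G w)) e \<in> verts (rule S (ecol G w))"
      using rule[of w] by (auto simp: fin_digraph_def wf_digraph_def)
    then show "tail (gr (replace_edges S G)) f \<in> verts (gr (replace_edges S G))"
      and "head (gr (replace_edges S G)) f \<in> verts (gr (replace_edges S G))"
      using f by (auto simp: replace_edges_simps)
  next
    show "finite (verts (gr (replace_edges S G)))"
      unfolding replace_edges_simps V using finV by (intro finite_UnI finite_imageI finite_SigmaI) auto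
    show "finite (arcs (gr (replace_edges S G)))"
      unfolding A using finA by (intro finite_imageI finite_SigmaI) auto
  qed
  show "ecol (replace_edges S G) f < ncol S" if "f \<in> arcs (gr (replace_edges S G))" for f
    using that S col by (auto simp: A replace_edges_simps is_eigs_def)
  have "card (arcs (gr (replace_edges S G))) \<le> card (SIGMA w:arcs (gr G). arcs (rule S (ecol G w)))"
    unfolding A using finA by (intro card_image_le finite_SigmaI) auto
  also have "\<dots> = (\<Sum>w\<in>arcs (gr G). card (arcs (rule S (ecol G w))))"
    using finA by (intro card_SigmaI) auto
  also have "\<dots> \<le> (\<Sum>w\<in>arcs (gr G). rule_arc_count S)"
    unfolding rule_arc_count_def using col by (intro sum_mono member_le_sum) auto
  finally show "card (arcs (gr (replace_edges S G))) \<le> rule_arc_count S * card (arcs (gr G))"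
    by (simp add: mult.commute)
qed

lemma eigs_iterate_wf:
  assumes S: "is_eigs S"
  shows "fin_digraph (gr (eigs_iterate S n)) \<and> (\<forall>w \<in> arcs (gr (eigs_iterate S n)). ecol (eigs_iterate S n) w < ncol S) \<and>
    End_pos \<in> verts (gr (eigs_iterate S n)) \<and>
    (End_pos, End_neg) \<in> (arcs (undirected (gr (eigs_iterate S n))))\<^sup>* \<and>
    card (arcs (gr (eigs_iterate S n))) \<le> rule_arc_count S ^ n"
proof (induction n)
  case 0
  have "fin_digraph (gr (single_edge (init_col S)))"
    by standard (auto simp: single_edge_def)
  then show ?case
    using S by (auto simp: eigs_iterate_def single_edge_def arcs_undirected is_eigs_def)
next
  case (Suc n)
  let ?G = "eigs_iterate S n"
  have eq: "eigs_iterate S (Suc n) = replace_edges S ?G"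
    by (simp add: eigs_iterate_def)
  have G: "fin_digraph (gr ?G)" and col: "\<And>w. w \<in> arcs (gr ?G) \<Longrightarrow> ecol ?G w < ncol S"
    using Suc.IH by auto
  have "rule_arc_count S * card (arcs (gr ?G)) \<le> rule_arc_count S ^ Suc n"
    using Suc.IH by simp
  then show ?case
    unfolding eq using replace_edges_wf[OF S G col] replace_edges_connects[OF S col] Suc.IH
    by (auto simp: replace_edges_simps(1) intro: order_trans)
qed

lemma Xi_eq: "Xi S n = gr (eigs_iterate S n)"
  by (simp add: Xi_def Xi_from_def eigs_iterate_def)

lemma Xi_ball_mean_exit_time:
  fixes r \<kappa> :: real
  assumes S: "is_eigs S" and r: "0 \<le> r" "r \<le> gdist (Xi S n) End_pos End_neg"
    and \<kappa>: "0 < \<kappa>" "\<kappa> \<le> 1 / 2"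
    and vol: "8 * real (rule_arc_count S) ^ n \<le> \<kappa>\<^sup>2 * exp (2 * \<kappa> * r)"
  shows "1 / (4 * \<kappa>\<^sup>2) \<le> enn2real (mean_exit_time (Xi S n) End_pos (gball (Xi S n) End_pos r))"
proof -
  have G: "wf_digraph (Xi S n)" "finite (verts (Xi S n))" "finite (arcs (Xi S n))" "End_pos \<in> verts (Xi S n)"
    and conn: "(End_pos, End_neg) \<in> (arcs (undirected (Xi S n)))\<^sup>*"
    and card: "card (arcs (Xi S n)) \<le> rule_arc_count S ^ n"
    using eigs_iterate_wf[OF S, of n]
    by (auto simp: Xi_eq fin_digraph_def intro: fin_digraph.finite_verts fin_digraph.finite_arcs)
  have "8 * real (card (arcs (Xi S n))) \<le> 8 * real (rule_arc_count S ^ n)"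
    using card by simp
  also have "\<dots> \<le> \<kappa>\<^sup>2 * exp (2 * \<kappa> * r)"
    using vol by simp
  finally have vol': "8 * real (card (arcs (Xi S n))) \<le> \<kappa>\<^sup>2 * exp (2 * \<kappa> * r)" .
  note b = ball_mean_exit_time[OF G conn xi_vertex.distinct(1) r(2,1) \<kappa> vol']
  \<comment> \<open>Finiteness matters here: \<open>enn2real\<close> sends infinity to 0 and is
    monotone only below infinity.\<close>
  have "enn2real (ennreal (1 / (4 * \<kappa>\<^sup>2))) \<le> enn2real (mean_exit_time (Xi S n) End_pos (gball (Xi S n) End_pos r))"
    using b by (intro enn2real_mono) auto
  then show ?thesis
    by simp
qed

text \<open>Level 0 gives \<open>cd \<le> Cd\<close>, and level 1 gives nonnegativity of
  \<open>rho_min S\<close>. If it were at most 1, then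
  \<open>4 * Cd \<le> cd * rho_min S ^ c0 \<le> cd \<le> Cd\<close>, which is absurd.\<close>

lemma scale_constants_bounds:
  assumes "scale_constants S cd Cd c0" and S: "is_eigs S"
  shows "1 < rho_min S" and "0 < cd" and "cd \<le> Cd" and "cd * rho_min S ^ m \<le> gdist (Xi S m) End_pos End_neg"
proof -
  let ?\<rho> = "rho_min S"
  have j: "init_col S < ncol S"
    using S by (simp add: is_eigs_def)
  have pos: "0 < cd" "0 < Cd" and big: "4 * Cd \<le> cd * ?\<rho> ^ c0"
    and dist: "\<And>m. cd * ?\<rho> ^ m \<le> real (gdist (Xi S m) End_pos End_neg)"
    using assms(1) j by (auto simp: scale_constants_def Xi_def)
  have diam: "real (gdist (Xi S m) End_pos End_neg) \<le> Cd * ?\<rho> ^ m" for m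
  proof -
    have "gdist (Xi S m) End_pos End_neg \<le> gdiam (Xi S m)" "real (gdiam (Xi S m)) \<le> Cd * ?\<rho> ^ m"
      using assms(1) j by (auto simp: scale_constants_def Xi_def)
    then show ?thesis by linarith
  qed
  show "0 < cd" "cd * ?\<rho> ^ m \<le> gdist (Xi S m) End_pos End_neg"
    by (fact pos dist)+
  show le: "cd \<le> Cd"
    using dist[of 0] diam[of 0] by simp
  have "0 \<le> Cd * ?\<rho> ^ 1"
    using diam[of 1] of_nat_0_le_iff order_trans by blast
  then have \<rho>: "0 \<le> ?\<rho>"
    using pos by (simp add: zero_le_mult_iff)
  show "1 < ?\<rho>"
  proof (rule ccontr)
    assume "\<not> 1 < ?\<rho>"
    then have "?\<rho> ^ c0 \<le> 1"
      using \<rho> by (intro power_le_one) auto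
    then have "cd * ?\<rho> ^ c0 \<le> cd * 1"
      using pos by (intro mult_left_mono) auto
    then show False
      using big le pos by linarith
  qed
qed

section \<open>The walk dimension\<close>

theorem proposition2p28:
  fixes S :: "('a, 'e) eigs" and cd Cd d :: real and c0 :: nat
  assumes "is_eigs S"
    and "canonical S"
    and "distance_positive S"
    and "degree_primitive S"
    and "scale_constants S cd Cd c0"
    and "has_walk_dimension S cd Cd c0 d"
  shows "d \<ge> 2"
proof -
  note S = assms(1)
  define \<rho> where "\<rho> = rho_min S"
  have \<rho>: "1 < \<rho>" and cd: "0 < cd" "cd \<le> Cd"
    and dist: "cd * \<rho> ^ n \<le> gdist (Xi S n) End_pos End_neg" for n
    using scale_constants_bounds[OF assms(5) S] by (auto simp: \<rho>_def)
  \<comment> \<open>Halving n leaves room for both margins of admissibility as soon as n \<ge> 2 *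
    c0, while the radius still grows exponentially in n.\<close>
  define r where "r n = cd * \<rho> ^ (n div 2)" for n
  define E where "E n = enn2real (mean_exit_time (Xi S n) End_pos (gball (Xi S n) End_pos (r n)))" for n
  have End_pos: "End_pos \<in> verts (Xi S 0)"
    by (simp add: Xi_def Xi_from_def single_edge_def)
  then have "birth_level S End_pos = 0"
    by (simp add: birth_level_def)
  moreover have "filterlim r at_top sequentially"
    unfolding r_def using \<rho> cd by real_asymp
  moreover have "\<forall>\<^sub>F n in sequentially. c0 \<le> n div 2 \<and> n div 2 + 0 + c0 \<le> n \<and>
      cd * \<rho> ^ (n div 2) \<le> r n \<and> r n \<le> Cd * \<rho> ^ (n div 2)"
    using eventually_ge_at_top[of "2 * c0"] by eventually_elim (use cd \<rho> in \<open>auto simp: r_def\<close>)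
  ultimately have "admissible S cd Cd c0 End_pos r"
    unfolding admissible_def \<rho>_def by (auto intro!: exI[of _ "\<lambda>n. n div 2"])
  then have "(\<lambda>n. ln (E n) / ln (r n)) \<longlonglongrightarrow> d"
    using assms(6) End_pos unfolding has_walk_dimension_def E_def Xi_verts_def by blast
  \<comment> \<open>Passing to even n removes the rounding in \<open>n div 2\<close>.\<close>
  then have lim: "(\<lambda>k. ln (E (2 * k)) / ln (r (2 * k))) \<longlonglongrightarrow> d"
    by (rule LIMSEQ_subseq_LIMSEQ[of _ _ "\<lambda>k. 2 * k", unfolded comp_def]) (simp add: strict_mono_def)
  \<comment> \<open>Adding 1 makes A \<ge> 1, so its powers increase.\<close>
  define A where "A = real (rule_arc_count S) + 1"
  define a where "a = ln (A * \<rho>)"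
  have A: "1 \<le> A"
    by (simp add: A_def)
  have "1 < A * \<rho>"
    using A \<rho> less_1_mult[of A \<rho>] by (cases "A = 1") auto
  then have a: "0 < a" "exp a = A * \<rho>"
    by (simp_all add: a_def)
  \<comment> \<open>Chosen so that \<open>2 * \<kappa> k * r (2 * k) = 4 * a * k\<close>. The
    exponential \<open>(A * \<rho>) ^ (4 * k)\<close> then beats both the edge growth
    \<open>A ^ (2 * k)\<close> and the factor \<open>\<rho> ^ (2 * k)\<close> lost in
    \<open>(\<kappa> k)\<^sup>2\<close>.\<close>
  define \<kappa> where "\<kappa> k = 2 * a * real k / (cd * \<rho> ^ k)" for k :: nat
  have E_lower: "\<forall>\<^sub>F k in sequentially. 1 / (4 * (\<kappa> k)\<^sup>2) \<le> E (2 * k)"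
  proof -
    have "(\<lambda>k. \<kappa> k) \<longlonglongrightarrow> 0"
      unfolding \<kappa>_def using \<rho> cd a by real_asymp
    then have ev1: "\<forall>\<^sub>F k in sequentially. \<kappa> k < 1 / 2"
      by (rule order_tendstoD) simp
    \<comment> \<open>What remains of the volume condition after the exponentials cancel.\<close>
    have ev2: "\<forall>\<^sub>F k in sequentially. 8 * cd\<^sup>2 \<le> (2 * a * real k)\<^sup>2"
      using a by real_asymp
    show ?thesis
      using ev1 ev2 eventually_gt_at_top[of 0]
    proof eventually_elim
      case (elim k)
      have \<rho>k: "0 < \<rho> ^ k" "\<rho> ^ k \<le> \<rho> ^ (2 * k)"
        using \<rho> by (auto intro: power_increasing)
      have rk: "r (2 * k) = cd * \<rho> ^ k"
        by (simp add: r_def)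
      have \<kappa>k: "0 < \<kappa> k"
        using elim a cd \<rho>k by (simp add: \<kappa>_def)
      have "\<kappa> k * (cd * \<rho> ^ k) = 2 * a * real k"
        using cd \<rho> by (simp add: \<kappa>_def)
      then have "2 * \<kappa> k * r (2 * k) = real (4 * k) * a"
        unfolding rk by (simp add: mult_ac)
      then have "exp (2 * \<kappa> k * r (2 * k)) = (A * \<rho>) ^ (4 * k)"
        using a(2) by (simp only: exp_of_nat_mult)
      also have "\<dots> \<ge> A ^ (2 * k) * \<rho> ^ (2 * k)"
        using A \<rho> by (auto simp: power_mult_distrib intro!: mult_mono power_increasing)
      finally have ex: "A ^ (2 * k) * (\<rho> ^ k)\<^sup>2 \<le> exp (2 * \<kappa> k * r (2 * k))"
        by (simp add: power_mult[symmetric] mult.commute)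
      have "8 * real (rule_arc_count S) ^ (2 * k) \<le> 8 * A ^ (2 * k)"
        by (simp add: A_def power_mono)
      also have "\<dots> \<le> (2 * a * real k / cd)\<^sup>2 * A ^ (2 * k)"
        using elim cd A by (intro mult_right_mono) (auto simp: power_divide le_divide_eq)
      also have "\<dots> = (\<kappa> k)\<^sup>2 * (A ^ (2 * k) * (\<rho> ^ k)\<^sup>2)"
        using \<rho> by (simp add: \<kappa>_def power_divide power_mult_distrib)
      also have "\<dots> \<le> (\<kappa> k)\<^sup>2 * exp (2 * \<kappa> k * r (2 * k))"
        by (intro mult_left_mono ex) auto
      finally have vol: "8 * real (rule_arc_count S) ^ (2 * k) \<le> (\<kappa> k)\<^sup>2 * exp (2 * \<kappa> k * r (2 * k))" .
      \<comment> \<open>The radius does not exceed the distance between the two ends, so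
        \<open>End_neg\<close> lies outside the ball.\<close>
      have "r (2 * k) \<le> cd * \<rho> ^ (2 * k)"
        using \<rho>k cd by (simp add: rk)
      also note dist[of "2 * k"]
      finally show ?case
        unfolding E_def using elim \<kappa>k vol cd \<rho>k by (intro Xi_ball_mean_exit_time[OF S]) (auto simp: rk)
    qed
  qed
  \<comment> \<open>The bound equals \<open>r\<^sup>2 / (16 * a\<^sup>2 * k\<^sup>2)\<close> with r
    = \<open>r (2 * k)\<close>. As \<open>ln r\<close> is linear in k up to a constant, the
    polynomial factor contributes only order \<open>ln k / k\<close> to the quotient.\<close>
  have "(\<lambda>k. ln (1 / (4 * (\<kappa> k)\<^sup>2)) / ln (r (2 * k))) \<longlonglongrightarrow> 2"
    unfolding \<kappa>_def r_def using \<rho> cd a by simp real_asymp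
  moreover have "\<forall>\<^sub>F k in sequentially. ln (1 / (4 * (\<kappa> k)\<^sup>2)) / ln (r (2 * k)) \<le> ln (E (2 * k)) / ln (r (2 * k))"
  proof -
    \<comment> \<open>Makes \<open>ln (r (2 * k))\<close> positive, so dividing by it preserves the
      inequality.\<close>
    have "\<forall>\<^sub>F k in sequentially. 1 < cd * \<rho> ^ k"
      using \<rho> cd by real_asymp
    then show ?thesis
      using E_lower eventually_gt_at_top[of 0]
    proof eventually_elim
      case (elim k)
      have "0 < \<kappa> k"
        using elim a cd \<rho> by (simp add: \<kappa>_def)
      then have "ln (1 / (4 * (\<kappa> k)\<^sup>2)) \<le> ln (E (2 * k))"
        using elim by (intro ln_mono) auto
      then show ?case
        using elim by (intro divide_right_mono) (auto simp: r_def)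
    qed
  qed
  ultimately show ?thesis
    using lim by (intro tendsto_le[OF sequentially_bot lim])
qed

end
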